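(* Let formal Lie series $A_X(X,Y)_{\mathrm{odd}}$, $B_X(X,Y)_{\mathrm{odd}}$ be defined by \[X\otimes A_X(X,Y)_{\mathrm{odd}}+Y\otimes B_X(X,Y)_{\mathrm{odd}}=\delta^{\mathrm L}_X\bigl((X+Y-\mathrm{BCH}(Y,X))_{\mathrm{even}}\bigr),\] and let $A_Y(X,Y)_{\mathrm{odd}}$, $B_Y(X,Y)_{\mathrm{odd}}$ be defined by \[X\otimes A_Y(X,Y)_{\mathrm{odd}}+Y\otimes B_Y(X,Y)_{\mathrm{odd}}=\delta^{\mathrm L}_Y\bigl((X+Y-\mathrm{BCH}(Y,X))_{\mathrm{even}}\bigr).\] Then, for either choice $V=X$ or $V=Y$, the following hold: (a) $(X+Y-\mathrm{BCH}(Y,X))_{\mathrm{even}}=[X,A_V(X,Y)_{\mathrm{odd}}]+[Y,B_V(X,Y)_{\mathrm{odd}}]$; (b') \begin{multline*}\mathrm{Tr}\bigl(\mathrm E^{\mathrm R}_X(\eta(\mathrm{ad}\,X)A_V(X,Y)_{\mathrm{odd}})\bigr)+\mathrm{Tr}\bigl(\mathrm E^{\mathrm R}_Y(\eta(\mathrm{ad}\,Y)B_V(X,Y)_{\mathrm{odd}})\bigr)\\=\tfrac12\mathrm{Tr}\bigl((\beta(X)+\beta(Y)-\beta(\mathrm{BCH}(X,Y))-1)_{\mathrm{odd}}\bigr)-\tfrac12\mathrm{Tr}\,\mathrm E^{\mathrm R}_X\bigl((X+Y-\mathrm{BCH}(Y,X))_{\mathrm{odd}}\bigr).\end{multline*}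
   Context: The coefficient ring $K$ is commutative with $\mathbb Q\subset K$. All series are formal noncommutative power series in $X,Y$; formal Lie series are identified with series of commutator polynomials among them. $\mathrm{BCH}(X,Y)=\log((\exp X)(\exp Y))$, which is a formal Lie series by the Baker–Campbell–Hausdorff theorem. The subscripts "even" and "odd" select the parts of even, respectively odd, total degree in $X,Y$ jointly. $\mathrm{ad}\,S:W\mapsto[S,W]$. The formal power series $\beta(u)=\frac{u}{\mathrm e^u-1}$ and $\eta(u)=\beta(u)+\frac12u=1+\frac1{12}u^2+\cdots$ (an even series). $\mathrm{Tr}$ is the formal trace: the linear map (applied degreewise to series) sending each associative monomial to its cyclic symmetrization (so that $\mathrm{Tr}(UV)=\mathrm{Tr}(VU)$). $\mathrm E^{\mathrm R}_X$ and $\mathrm E^{\mathrm R}_Y$ are the linear maps selecting the associative monomials ending with $X$, respectively with $Y$. The maps $\delta^{\mathrm L}_X,\delta^{\mathrm L}_Y$: for a variable $V\in\{X,Y\}$ and a series $P=\sum_{n\ge2}\sum_u c_u\,u_1\cdots u_n$, where $u=(u_1,\ldots,u_n)$ with $u_i\in\{X,Y\}$, and $c_u=0$ whenever $V$ does not occur in $u$, put \[\delta^{\mathrm L}_V(P)=\sum_{n\ge2}\sum_{u}\frac{w_V(u_n)}{w_V(u_1)+\cdots+w_V(u_n)}\,c_u\;u_1\otimes[u_2,\ldots,[u_{n-1},u_n]\ldots],\] where $w_V(V)=1$ and $w_V$ of the other variable is $0$ (for $n=2$ the second tensor factor is $u_2$). The result has the form $X\otimes A+Y\otimes B$ with uniquely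 determined formal Lie series $A,B$. (Every monomial of $X+Y-\mathrm{BCH}(Y,X)$ contains both $X$ and $Y$, so this applies.) *)

theory Defs
  imports
    "HOL-Computational_Algebra.Formal_Power_Series"
    "HOL-Library.Function_Algebras"
begin

section \<open>Coefficient rings\<close>

text \<open>A commutative ring \<open>K\<close> with \<open>\<rat> \<subseteq> K\<close>; the inclusion is the ring homomorphism
  \<open>of_Q\<close>. It is automatically injective, since \<open>0 \<noteq> 1\<close> in \<^class>\<open>comm_ring_1\<close>.\<close>

class comm_rat_algebra = comm_ring_1 +
  fixes of_Q :: "rat \<Rightarrow> 'a"
  assumes of_Q_1: "of_Q 1 = 1"
    and of_Q_add: "of_Q (a + b) = of_Q a + of_Q b"
    and of_Q_mult: "of_Q (a * b) = of_Q a * of_Q b"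

lemma of_Q_0: "of_Q 0 = (0 :: 'k::comm_rat_algebra)"
  using of_Q_add[of 0 0] by simp

lemma inj_of_Q: "inj (of_Q :: rat \<Rightarrow> 'k::comm_rat_algebra)"
proof (rule injI)
  fix a b :: rat
  assume eq: "(of_Q a :: 'k) = of_Q b"
  have "(of_Q (a - b) :: 'k) + of_Q b = of_Q a"
    by (simp flip: of_Q_add)
  then have z: "(of_Q (a - b) :: 'k) = 0"
    using eq by simp
  show "a = b"
  proof (rule ccontr)
    assume "a \<noteq> b"
    then have "(of_Q (a - b) :: 'k) * of_Q (inverse (a - b)) = 1"
      by (simp flip: of_Q_mult add: of_Q_1)
    then show False
      using z by simp
  qed
qed

instantiation rat :: comm_rat_algebra
begin
definition of_Q_rat :: "rat \<Rightarrow> rat" where "of_Q_rat a = a"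
instance by standard (simp_all add: of_Q_rat_def)
end

section \<open>Formal noncommutative power series in two variables\<close>

datatype letter = X | Y

text \<open>A series is the family of coefficients of the associative monomials, which are words in
  the letters \<open>X\<close>, \<open>Y\<close>.\<close>

typedef 'k ncs = "UNIV :: (letter list \<Rightarrow> 'k) set"
  morphisms coeff Ncs ..

lemma ncs_eqI: "(\<And>w. coeff f w = coeff g w) \<Longrightarrow> f = g"
  by (simp add: coeff_inject[symmetric] fun_eq_iff)

lemma coeff_Ncs [simp]: "coeff (Ncs f) w = f w"
  by (simp add: Ncs_inverse)

instantiation ncs :: (comm_ring_1) ring_1
begin

definition "0 = Ncs (\<lambda>w. 0)"
definition "1 = Ncs (\<lambda>w. if w = [] then 1 else 0)"
definition "f + g = Ncs (\<lambda>w. coeff f w + coeff g w)"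
definition "- f = Ncs (\<lambda>w. - coeff f w)"
definition "f - g = Ncs (\<lambda>w. coeff f w - coeff g w)"
definition "f * g = Ncs (\<lambda>w. \<Sum>i\<le>length w. coeff f (take i w) * coeff g (drop i w))"

instance
proof
  fix a b c :: "'a ncs"
  show "a + b + c = a + (b + c)" "a + b = b + a" "0 + a = a" "- a + a = 0" "a - b = a + - b"
    by (rule ncs_eqI; simp add: plus_ncs_def zero_ncs_def uminus_ncs_def minus_ncs_def)+
  show "(a + b) * c = a * c + b * c" "a * (b + c) = a * b + a * c"
    by (rule ncs_eqI; simp add: plus_ncs_def times_ncs_def algebra_simps sum.distrib)+
  show "(0::'a ncs) \<noteq> 1"
  proof
    assume "(0::'a ncs) = 1"
    then have "coeff (0::'a ncs) [] = coeff 1 []" by simp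
    then show False by (simp add: zero_ncs_def one_ncs_def)
  qed
  show "1 * a = a"
  proof (rule ncs_eqI)
    fix w
    have "coeff (1 * a) w = (\<Sum>i\<le>length w. if i = 0 then coeff a w else 0)"
      unfolding times_ncs_def one_ncs_def coeff_Ncs by (intro sum.cong) auto
    then show "coeff (1 * a) w = coeff a w" by simp
  qed
  show "a * 1 = a"
  proof (rule ncs_eqI)
    fix w
    have "coeff (a * 1) w = (\<Sum>i\<le>length w. if i = length w then coeff a w else 0)"
      unfolding times_ncs_def one_ncs_def coeff_Ncs by (intro sum.cong) auto
    then show "coeff (a * 1) w = coeff a w" by simp
  qed
  show "a * b * c = a * (b * c)"
  proof (rule ncs_eqI)
    fix w :: "letter list"
    let ?n = "length w"
    let ?t = "\<lambda>i j. coeff a (take i w) * coeff b (take (j - i) (drop i w)) * coeff c (drop j w)"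
    have "coeff (a * b * c) w = (\<Sum>j\<le>?n. \<Sum>i\<le>j. ?t i j)"
      unfolding times_ncs_def coeff_Ncs sum_distrib_right
      by (intro sum.cong refl) (auto simp: min_def drop_take)
    also have "\<dots> = (\<Sum>i\<le>?n. \<Sum>j\<in>{i..?n}. ?t i j)"
      unfolding sum.Sigma[OF finite_atMost ballI[OF finite_atMost]]
        sum.Sigma[OF finite_atMost ballI[OF finite_atLeastAtMost]]
      by (rule sum.reindex_bij_witness[of _ "\<lambda>(i,j). (j,i)" "\<lambda>(i,j). (j,i)"]) auto
    also have "\<dots> = (\<Sum>i\<le>?n. \<Sum>k\<le>?n - i. ?t i (i + k))"
    proof (rule sum.cong[OF refl])
      fix i
      assume "i \<in> {..?n}"
      then show "(\<Sum>j\<in>{i..?n}. ?t i j) = (\<Sum>k\<le>?n - i. ?t i (i + k))"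
        by (intro sum.reindex_bij_witness[of _ "\<lambda>k. i + k" "\<lambda>j. j - i"]) auto
    qed
    also have "\<dots> = coeff (a * (b * c)) w"
      unfolding times_ncs_def coeff_Ncs sum_distrib_left
      by (intro sum.cong refl) (auto simp: mult.assoc add.commute)
    finally show "coeff (a * b * c) w = coeff (a * (b * c)) w" .
  qed
qed

end

definition monom :: "letter list \<Rightarrow> 'k::comm_ring_1 ncs" where
  "monom u = Ncs (\<lambda>w. if w = u then 1 else 0)"

abbreviation var :: "letter \<Rightarrow> 'k::comm_ring_1 ncs" where
  "var v \<equiv> monom [v]"

definition scale :: "'k::comm_ring_1 \<Rightarrow> 'k ncs \<Rightarrow> 'k ncs" where
  "scale c P = Ncs (\<lambda>w. c * coeff P w)"

definition hom_part :: "nat \<Rightarrow> 'k::comm_ring_1 ncs \<Rightarrow> 'k ncs" where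
  "hom_part n P = Ncs (\<lambda>w. if length w = n then coeff P w else 0)"

definition even_part :: "'k::comm_ring_1 ncs \<Rightarrow> 'k ncs" where
  "even_part P = Ncs (\<lambda>w. if even (length w) then coeff P w else 0)"

definition odd_part :: "'k::comm_ring_1 ncs \<Rightarrow> 'k ncs" where
  "odd_part P = Ncs (\<lambda>w. if odd (length w) then coeff P w else 0)"

section \<open>Formal Lie series\<close>

definition bracket :: "'k::comm_ring_1 ncs \<Rightarrow> 'k ncs \<Rightarrow> 'k ncs" where
  "bracket P Q = P * Q - Q * P"

inductive_set lie_polynomials :: "'k::comm_ring_1 ncs set" where
  "0 \<in> lie_polynomials"
| "var v \<in> lie_polynomials"
| "P \<in> lie_polynomials \<Longrightarrow> Q \<in> lie_polynomials \<Longrightarrow> P + Q \<in> lie_polynomials"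
| "P \<in> lie_polynomials \<Longrightarrow> scale c P \<in> lie_polynomials"
| "P \<in> lie_polynomials \<Longrightarrow> Q \<in> lie_polynomials \<Longrightarrow> bracket P Q \<in> lie_polynomials"

definition lie_series :: "'k::comm_ring_1 ncs \<Rightarrow> bool" where
  "lie_series P \<longleftrightarrow> (\<forall>n. hom_part n P \<in> lie_polynomials)"

section \<open>Substitution into rational power series\<close>

text \<open>\<open>f(S) = \<Sum>n. f\<^sub>n S\<^sup>n\<close> for a series \<open>S\<close> without constant term: then \<open>S\<^sup>n\<close> has no monomials
  shorter than \<open>n\<close>, so the coefficientwise sums below are complete.
  The same applies to \<open>f(ad S)(T) = \<Sum>n. f\<^sub>n (ad S)\<^sup>n T\<close>.\<close>

definition subst :: "rat fps \<Rightarrow> 'k::comm_rat_algebra ncs \<Rightarrow> 'k ncs" where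
  "subst f S = Ncs (\<lambda>w. \<Sum>n\<le>length w. of_Q (fps_nth f n) * coeff (S ^ n) w)"

definition ad_subst :: "rat fps \<Rightarrow> 'k::comm_rat_algebra ncs \<Rightarrow> 'k ncs \<Rightarrow> 'k ncs" where
  "ad_subst f S T = Ncs (\<lambda>w. \<Sum>n\<le>length w. of_Q (fps_nth f n) * coeff ((bracket S ^^ n) T) w)"

definition nc_exp :: "'k::comm_rat_algebra ncs \<Rightarrow> 'k ncs" where
  "nc_exp S = subst (fps_exp 1) S"

text \<open>\<^term>\<open>fps_ln 1\<close> is the expansion of \<open>log (1 + u)\<close>; the argument of \<open>nc_log\<close> is meant to have
  constant term \<open>1\<close>.\<close>

definition nc_log :: "'k::comm_rat_algebra ncs \<Rightarrow> 'k ncs" where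
  "nc_log S = subst (fps_ln 1) (S - 1)"

definition BCH :: "'k::comm_rat_algebra ncs \<Rightarrow> 'k ncs \<Rightarrow> 'k ncs" where
  "BCH S T = nc_log (nc_exp S * nc_exp T)"

definition beta :: "rat fps" where
  "beta = fps_X / (fps_exp 1 - 1)"

definition eta :: "rat fps" where
  "eta = beta + fps_const (1/2) * fps_X"

section \<open>Trace and end selection\<close>

definition cyc_sym :: "letter list \<Rightarrow> 'k::comm_rat_algebra ncs" where
  "cyc_sym u = (if u = [] then 1
     else scale (of_Q (1 / of_nat (length u))) (\<Sum>i<length u. monom (rotate i u)))"

text \<open>Only monomials \<open>u\<close> of the same degree as \<open>w\<close> contribute to the coefficient of \<open>w\<close>.\<close>

definition Tr :: "'k::comm_rat_algebra ncs \<Rightarrow> 'k ncs" where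
  "Tr P = Ncs (\<lambda>w. \<Sum>u | length u = length w. coeff P u * coeff (cyc_sym u) w)"

definition ER :: "letter \<Rightarrow> 'k::comm_ring_1 ncs \<Rightarrow> 'k ncs" where
  "ER v P = Ncs (\<lambda>w. if w \<noteq> [] \<and> last w = v then coeff P w else 0)"

section \<open>The maps delta\<close>

text \<open>An element of the completed tensor square of the algebra of series is the family of
  coefficients of the \<open>u \<otimes> w\<close>, for monomials \<open>u\<close>, \<open>w\<close>; addition is pointwise.\<close>

type_synonym 'k tens = "letter list \<Rightarrow> letter list \<Rightarrow> 'k"

definition tensor :: "'k::comm_ring_1 ncs \<Rightarrow> 'k ncs \<Rightarrow> 'k tens" where
  "tensor P Q = (\<lambda>u w. coeff P u * coeff Q w)"

text \<open>\<open>[u\<^sub>1, [u\<^sub>2, \<dots> [u\<^sub>n\<^sub>-\<^sub>1, u\<^sub>n] \<dots>]]\<close>; the value on the empty word is never used.\<close>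

fun nested_bracket :: "letter list \<Rightarrow> 'k::comm_ring_1 ncs" where
  "nested_bracket [] = 0"
| "nested_bracket [v] = var v"
| "nested_bracket (v # u) = bracket (var v) (nested_bracket u)"

definition weight :: "letter \<Rightarrow> letter \<Rightarrow> rat" where
  "weight v x = (if x = v then 1 else 0)"

text \<open>The term of a monomial \<open>u\<close> contributes only to the coefficients of those \<open>p \<otimes> q\<close> for which
  the degrees of \<open>p\<close> and \<open>q\<close> add up to the degree of \<open>u\<close>. The map is meant for series all of
  whose monomials have degree at least two and contain \<open>v\<close>; other monomials are ignored
  (for those not containing \<open>v\<close> the quotient of weights is \<open>0 / 0 = 0\<close>).\<close>

definition deltaL :: "letter \<Rightarrow> 'k::comm_rat_algebra ncs \<Rightarrow> 'k tens" where
  "deltaL v P = (\<lambda>p q. \<Sum>u | 2 \<le> length u \<and> length u = length p + length q.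
     of_Q (weight v (last u) / (\<Sum>x\<leftarrow>u. weight v x)) * coeff P u *
     tensor (var (hd u)) (nested_bracket (tl u)) p q)"

text \<open>\<open>deltaL v P\<close> has the form \<open>X \<otimes> A + Y \<otimes> B\<close> with unique formal Lie series \<open>A\<close>, \<open>B\<close>.\<close>

lemma finite_words: "finite {u :: letter list. length u = n}"
proof -
  have "(UNIV :: letter set) = {X, Y}"
    using letter.exhaust by auto
  then have "finite (UNIV :: letter set)"
    by (metis finite.emptyI finite.insertI)
  from finite_lists_length_eq[OF this, of n] show ?thesis by simp
qed

lemma coeff_scale [simp]: "coeff (scale c P) w = c * coeff P w"
  by (simp add: scale_def)

lemma coeff_sum: "coeff (sum f I) w = (\<Sum>i\<in>I. coeff (f i) w)"
  by (induction I rule: infinite_finite_induct) (simp_all add: zero_ncs_def plus_ncs_def)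

lemma sum_lie_polynomials:
  "(\<And>i. i \<in> I \<Longrightarrow> f i \<in> lie_polynomials) \<Longrightarrow> sum f I \<in> lie_polynomials"
  by (induction I rule: infinite_finite_induct) (auto intro: lie_polynomials.intros)

lemma nested_bracket_lie: "nested_bracket u \<in> lie_polynomials"
  by (induction u rule: nested_bracket.induct) (auto intro: lie_polynomials.intros)

lemma coeff_mult_homogeneous:
  assumes "\<And>w. length w \<noteq> m \<Longrightarrow> coeff P w = 0" "\<And>w. length w \<noteq> n \<Longrightarrow> coeff Q w = 0"
    and "length w \<noteq> m + n"
  shows "coeff (P * Q) w = 0"
  unfolding times_ncs_def coeff_Ncs
proof (rule sum.neutral, rule ballI)
  fix i assume "i \<in> {..length w}"
  then have "length (take i w) \<noteq> m \<or> length (drop i w) \<noteq> n"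
    using assms(3) by auto
  then show "coeff P (take i w) * coeff Q (drop i w) = 0"
    using assms(1,2) by auto
qed

lemma coeff_nested_bracket: "length w \<noteq> length u \<Longrightarrow> coeff (nested_bracket u) w = (0 :: 'k::comm_ring_1)"
proof (induction u arbitrary: w rule: nested_bracket.induct)
  case (3 v x u)
  have v: "coeff (var v) w = (0 :: 'k)" if "length w \<noteq> 1" for w
    using that by (auto simp: monom_def)
  have "coeff (var v * nested_bracket (x # u)) w = (0 :: 'k)"
    by (rule coeff_mult_homogeneous[OF v "3.IH"]) (use "3.prems" in auto)
  moreover have "coeff (nested_bracket (x # u) * var v) w = (0 :: 'k)"
    by (rule coeff_mult_homogeneous[OF "3.IH" v]) (use "3.prems" in auto)
  ultimately show ?case
    by (simp add: bracket_def minus_ncs_def)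
qed (auto simp: zero_ncs_def monom_def)

lemma deltaL_well_defined:
  fixes P :: "'k::comm_rat_algebra ncs"
  shows "\<exists>!(A, B). lie_series A \<and> lie_series B \<and>
    tensor (var X) A + tensor (var Y) B = deltaL v P"
proof -
  define W where "W z n = {u. 2 \<le> length u \<and> length u = Suc n \<and> hd u = z}" for z :: letter and n
  define c where "c u = of_Q (weight v (last u) / (\<Sum>x\<leftarrow>u. weight v x)) * coeff P u" for u
  define S where "S z = Ncs (\<lambda>q. deltaL v P [z] q)" for z
  have fin: "finite {u :: letter list. 2 \<le> length u \<and> length u = n}" for n
    by (rule finite_subset[OF _ finite_words[of n]]) auto
  have zero: "deltaL v P p q = 0" if "length p \<noteq> 1" for p q
    unfolding deltaL_def tensor_def using that by (intro sum.neutral) (auto simp: monom_def)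
  have S: "deltaL v P [z] q = (\<Sum>u\<in>W z (length q). c u * coeff (nested_bracket (tl u)) q)" for z q
    unfolding deltaL_def tensor_def W_def c_def
    by (rule sum.mono_neutral_cong_right) (use fin in \<open>auto simp: monom_def\<close>)
  have lie: "lie_series (S z)" for z
    unfolding lie_series_def
  proof
    fix n
    have "hom_part n (S z) = (\<Sum>u\<in>W z n. scale (c u) (nested_bracket (tl u)))"
    proof (rule ncs_eqI)
      fix w
      show "coeff (hom_part n (S z)) w =
          coeff (\<Sum>u\<in>W z n. scale (c u) (nested_bracket (tl u))) w"
      proof (cases "length w = n")
        case True
        then show ?thesis by (simp add: hom_part_def S_def S coeff_sum)
      next
        case False
        then have "coeff (nested_bracket (tl u)) w = (0::'k)" if "u \<in> W z n" for u
          using that by (intro coeff_nested_bracket) (auto simp: W_def)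
        then show ?thesis using False by (simp add: hom_part_def coeff_sum)
      qed
    qed
    then show "hom_part n (S z) \<in> lie_polynomials"
      by (auto intro!: sum_lie_polynomials lie_polynomials.intros nested_bracket_lie)
  qed
  have val: "(tensor (var X) A + tensor (var Y) B) p q =
      (if p = [X] then coeff A q else if p = [Y] then coeff B q else 0)" for A B :: "'k ncs" and p q
    by (simp add: tensor_def monom_def)
  have eq_iff: "tensor (var X) A + tensor (var Y) B = deltaL v P \<longleftrightarrow> A = S X \<and> B = S Y"
    for A B :: "'k ncs"
  proof
    assume *: "tensor (var X) A + tensor (var Y) B = deltaL v P"
    have "coeff A q = deltaL v P [X] q" "coeff B q = deltaL v P [Y] q" for q
      unfolding *[symmetric] val by simp_all
    then show "A = S X \<and> B = S Y"
      by (auto intro!: ncs_eqI simp: S_def)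
  next
    assume *: "A = S X \<and> B = S Y"
    show "tensor (var X) A + tensor (var Y) B = deltaL v P"
    proof (intro ext)
      fix p q
      consider "p = [X]" | "p = [Y]" | "length p \<noteq> 1"
        by (cases p; cases "hd p") auto
      then show "(tensor (var X) A + tensor (var Y) B) p q = deltaL v P p q"
        unfolding val using * zero[of p q] by cases (auto simp: S_def)
    qed
  qed
  show ?thesis
    by (rule ex1I[of _ "(S X, S Y)"]) (auto simp: eq_iff lie)
qed

end

theory Submission
  imports Defs
begin

text \<open>For letters \<open>a \<noteq> b\<close> put \<open>L = BCH a b\<close> and let \<open>K\<close>, called \<open>sol a b\<close> below, be the series
  \<open>(e\<^sup>u - 1)/(2u)\<close> at \<open>u = ad b\<close>, applied to \<open>L - b\<close>. Since \<open>e\<^sup>u\<close> maps \<open>L\<close> to \<open>BCH b a\<close>, and the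
  automorphism \<open>X \<mapsto> - X\<close>, \<open>Y \<mapsto> - Y\<close> maps \<open>L\<close> to \<open>- BCH b a\<close>, the bracket \<open>[b, K]\<close> is minus the
  even part of \<open>L\<close>, and \<open>\<eta>(u) K\<close> is half the odd part of \<open>L - b\<close>. A Dynkin formula for \<open>K\<close>,
  which follows from that for \<open>L\<close>, shows that \<open>deltaL a [b, K]\<close> is \<open>b \<otimes> K\<close>. So one of the series
  \<open>A\<close>, \<open>B\<close> vanishes and the other one is \<open>\<plusminus> K\<close>.

  In (b') the \<open>\<beta>\<close>-part of the right hand side vanishes, because \<open>BCH X Y\<close> and \<open>BCH Y X\<close> are
  conjugate and, up to sign, interchanged by the automorphism above, and because \<open>BCH X Y\<close> has
  the trace of \<open>X + Y\<close>. For \<open>V = Y\<close> what is left is the formula for \<open>\<eta>(u) K\<close>; for \<open>V = X\<close> one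
  also uses that the odd part of \<open>X + Y - BCH Y X\<close> has trace 0.\<close>

section \<open>Coefficients\<close>

lemma of_Q_uminus: "of_Q (- a) = - (of_Q a :: 'k::comm_rat_algebra)"
  using of_Q_add[of a "- a"] by (simp add: of_Q_0 eq_neg_iff_add_eq_0 add.commute)

lemma of_Q_sum: "of_Q (sum f I) = (\<Sum>i\<in>I. of_Q (f i) :: 'k::comm_rat_algebra)"
  by (induction I rule: infinite_finite_induct) (simp_all add: of_Q_0 of_Q_add)

lemma of_Q_of_nat: "of_Q (of_nat n) = (of_nat n :: 'k::comm_rat_algebra)"
  by (induction n) (simp_all add: of_Q_0 of_Q_add of_Q_1)

lemma of_Q_inverse_mult_of_nat:
  assumes "n \<noteq> 0"
  shows "of_Q (1 / of_nat n) * of_nat n = (1 :: 'k::comm_rat_algebra)"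
proof -
  have "of_Q (1 / of_nat n) * of_nat n = (of_Q (1 / of_nat n * of_nat n) :: 'k)"
    by (simp only: of_Q_mult of_Q_of_nat)
  with assms show ?thesis
    by (simp add: of_Q_1)
qed

text \<open>Nonzero integers are invertible in \<open>'k\<close>, so they can be cancelled even in
  the presence of zero divisors. This turns statements about degree derivations into statements
  about coefficients.\<close>

lemma of_nat_mult_cancel:
  fixes x y :: "'k::comm_rat_algebra"
  assumes "n \<noteq> 0" "of_nat n * x = of_nat n * y"
  shows "x = y"
proof -
  have "z = of_Q (1 / of_nat n) * (of_nat n * z)" for z :: 'k
    using of_Q_inverse_mult_of_nat[OF assms(1), where 'k = 'k] by (simp flip: mult.assoc)
  then show ?thesis
    using assms(2) by metis
qed

lemma coeff_0 [simp]: "coeff 0 w = 0"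
  and coeff_1: "coeff 1 w = (if w = [] then 1 else 0)"
  and coeff_add [simp]: "coeff (P + Q) w = coeff P w + coeff Q w"
  and coeff_uminus [simp]: "coeff (- P) w = - coeff P w"
  and coeff_diff [simp]: "coeff (P - Q) w = coeff P w - coeff Q w"
  and coeff_mult: "coeff (P * Q) w = (\<Sum>i\<le>length w. coeff P (take i w) * coeff Q (drop i w))"
  and coeff_monom: "coeff (monom u) w = (if w = u then 1 else 0)"
  by (simp_all add: zero_ncs_def one_ncs_def plus_ncs_def uminus_ncs_def minus_ncs_def
      times_ncs_def monom_def)

lemma coeff_var_mult:
  "coeff (var v * P) w = (case w of [] \<Rightarrow> 0 | x # u \<Rightarrow> if x = v then coeff P u else 0)"
proof (cases w)
  case Nil
  then show ?thesis by (simp add: coeff_mult coeff_monom)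
next
  case (Cons x u)
  have "coeff (var v * P) w = (\<Sum>i\<le>length w. if i = 1 then coeff (var v) [x] * coeff P u else 0)"
    unfolding coeff_mult Cons
    by (intro sum.cong refl) (auto simp: coeff_monom take_Cons' drop_Cons' split: if_splits)
  also have "\<dots> = coeff (var v) [x] * coeff P u"
    by (subst sum.delta) (auto simp: Cons)
  finally show ?thesis using Cons by (simp add: coeff_monom)
qed

lemma coeff_mult_snoc:
  "coeff (P * Q) (u @ [v]) =
    (\<Sum>i\<le>length u. coeff P (take i u) * coeff Q (drop i u @ [v])) + coeff P (u @ [v]) * coeff Q []"
  by (simp add: coeff_mult)

lemma scale_0 [simp]: "scale 0 P = 0" and scale_1 [simp]: "scale 1 P = P"
  and scale_zero [simp]: "scale c 0 = 0"
  and scale_add: "scale c (P + Q) = scale c P + scale c Q"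
  and scale_diff: "scale c (P - Q) = scale c P - scale c Q"
  and scale_uminus: "scale c (- P) = - scale c P"
  and scale_plus: "scale (c + d) P = scale c P + scale d P"
  and scale_scale: "scale c (scale d P) = scale (c * d) P"
  by (simp_all add: ncs_eqI algebra_simps)

lemma scale_mult_left: "scale c P * Q = scale c (P * Q)"
  by (rule ncs_eqI) (simp add: coeff_mult sum_distrib_left mult.assoc)

lemma scale_mult_right: "P * scale c Q = scale c (P * Q)"
  by (rule ncs_eqI) (simp add: coeff_mult sum_distrib_left mult.left_commute)

lemma scale_half_double: "scale (of_Q (1/2)) P + scale (of_Q (1/2)) P = (P :: 'k::comm_rat_algebra ncs)"
  by (simp add: of_Q_1 flip: scale_plus of_Q_add)

section \<open>Order of vanishing and continuous linear maps\<close>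

text \<open>The degree filtration, given as a predicate rather than by a minimal degree, so that
  \<open>0\<close> lies in every level.\<close>

definition order_ge :: "nat \<Rightarrow> 'k::comm_ring_1 ncs \<Rightarrow> bool" where
  "order_ge n P \<longleftrightarrow> (\<forall>w. length w < n \<longrightarrow> coeff P w = 0)"

lemma order_ge_0 [simp]: "order_ge 0 P"
  by (simp add: order_ge_def)

lemma order_ge_mono: "order_ge n P \<Longrightarrow> m \<le> n \<Longrightarrow> order_ge m P"
  by (auto simp: order_ge_def)

lemma order_ge_diff: "order_ge n P \<Longrightarrow> order_ge n Q \<Longrightarrow> order_ge n (P - Q)"
  and order_ge_uminus: "order_ge n P \<Longrightarrow> order_ge n (- P)"
  and order_ge_scale: "order_ge n P \<Longrightarrow> order_ge n (scale c P)"
  by (auto simp: order_ge_def)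

lemma order_ge_mult:
  assumes "order_ge m P" "order_ge n Q"
  shows "order_ge (m + n) (P * Q)"
  unfolding order_ge_def
proof (intro allI impI)
  fix w :: "letter list"
  assume w: "length w < m + n"
  have "coeff P (take i w) * coeff Q (drop i w) = 0" if "i \<le> length w" for i
  proof -
    have "length (take i w) < m \<or> length (drop i w) < n"
      using w that by auto
    then show ?thesis using assms by (auto simp: order_ge_def)
  qed
  then show "coeff (P * Q) w = 0"
    by (simp add: coeff_mult)
qed

lemma order_ge_bracket: "order_ge m P \<Longrightarrow> order_ge n Q \<Longrightarrow> order_ge (m + n) (bracket P Q)"
  unfolding bracket_def using order_ge_mult[of m P n Q] order_ge_mult[of n Q m P]
  by (simp add: order_ge_diff add.commute)

lemma order_ge_var: "order_ge (Suc 0) (var v)"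
  by (simp add: order_ge_def coeff_monom)

lemma order_ge_coeff_Nil: "order_ge (Suc 0) P \<longleftrightarrow> coeff P [] = 0"
  by (simp add: order_ge_def)

lemma eq_if_order_ge_diff:
  assumes "\<And>n. order_ge n (P - Q)"
  shows "P = Q"
proof (rule ncs_eqI)
  fix w
  show "coeff P w = coeff Q w"
    using assms[of "Suc (length w)"] by (simp add: order_ge_def)
qed

definition linear_map :: "('k::comm_ring_1 ncs \<Rightarrow> 'k ncs) \<Rightarrow> bool" where
  "linear_map F \<longleftrightarrow> (\<forall>P Q. F (P + Q) = F P + F Q) \<and> (\<forall>c P. F (scale c P) = scale c (F P))"

lemma
  assumes "linear_map F"
  shows linear_map_add: "F (P + Q) = F P + F Q"
    and linear_map_scale: "F (scale c P) = scale c (F P)"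
    and linear_map_0: "F 0 = 0"
    and linear_map_uminus: "F (- P) = - F P"
    and linear_map_diff: "F (P - Q) = F P - F Q"
    and linear_map_sum: "F (sum g I) = (\<Sum>i\<in>I. F (g i))"
proof -
  show add: "F (P + Q) = F P + F Q" for P Q
    using assms by (auto simp: linear_map_def)
  show "F (scale c P) = scale c (F P)"
    using assms by (auto simp: linear_map_def)
  show zero: "F 0 = 0" using add[of 0 0] by simp
  show um: "F (- P) = - F P" for P
    using add[of P "- P"] zero by (simp add: eq_neg_iff_add_eq_0 add.commute)
  show "F (P - Q) = F P - F Q"
    using add[of P "- Q"] um by simp
  show "F (sum g I) = (\<Sum>i\<in>I. F (g i))"
    by (induction I rule: infinite_finite_induct) (simp_all add: zero add)
qed

text \<open>Continuity for the degree filtration. A uniform loss of \<open>c\<close> degrees is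
  allowed because stripping a letter, as \<open>rquot\<close> does, lowers the degree by
  one.\<close>

definition continuous_map :: "('k::comm_ring_1 ncs \<Rightarrow> 'k ncs) \<Rightarrow> bool" where
  "continuous_map F \<longleftrightarrow> linear_map F \<and> (\<exists>c. \<forall>n P. order_ge (n + c) P \<longrightarrow> order_ge n (F P))"

text \<open>Topological nilpotence: \<open>F ^^ n\<close> raises the order by \<open>n\<close>, so
  that every power series in \<open>F\<close> converges coefficientwise.\<close>

definition raising :: "('k::comm_ring_1 ncs \<Rightarrow> 'k ncs) \<Rightarrow> bool" where
  "raising F \<longleftrightarrow> linear_map F \<and> (\<forall>n P. order_ge n P \<longrightarrow> order_ge (Suc n) (F P))"

lemma raisingD: "raising F \<Longrightarrow> order_ge n P \<Longrightarrow> order_ge (Suc n) (F P)"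
  by (simp add: raising_def)

lemma continuous_mapI:
  assumes "linear_map F" "\<And>n P. order_ge (n + c) P \<Longrightarrow> order_ge n (F P)"
  shows "continuous_map F"
  using assms unfolding continuous_map_def by blast

lemma continuous_map_linear: "continuous_map F \<Longrightarrow> linear_map F"
  by (simp add: continuous_map_def)

lemma raising_continuous: "raising F \<Longrightarrow> continuous_map F"
  by (rule continuous_mapI[where c = 0])
    (auto simp: raising_def intro: order_ge_mono[OF _ le_SucI[OF order_refl]])

lemma raising_mult_left: "order_ge (Suc 0) S \<Longrightarrow> raising ((*) S)"
  unfolding raising_def linear_map_def using order_ge_mult[of "Suc 0" S]
  by (simp add: distrib_left scale_mult_right)

lemma linear_map_bracket: "linear_map (bracket S)"
  unfolding linear_map_def
  by (simp add: bracket_def algebra_simps scale_mult_left scale_mult_right scale_diff)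

lemma raising_bracket: "order_ge (Suc 0) S \<Longrightarrow> raising (bracket S)"
  unfolding raising_def using linear_map_bracket[of S] order_ge_bracket[of "Suc 0" S] by simp

lemma order_ge_funpow:
  assumes "raising F" "order_ge m P"
  shows "order_ge (m + n) ((F ^^ n) P)"
  using assms by (induction n) (auto dest: raisingD)

lemma linear_map_funpow: "linear_map F \<Longrightarrow> linear_map (F ^^ n)"
  by (induction n) (auto simp: linear_map_def)

section \<open>Power series in an operator\<close>

text \<open>A common form of \<open>subst\<close> (\<open>F\<close> is left multiplication, applied
  to \<open>1\<close>) and \<open>ad_subst\<close> (\<open>F\<close> is a bracket), so that the
  calculus of power series is developed once for both.\<close>

definition op_subst :: "rat fps \<Rightarrow> ('k::comm_rat_algebra ncs \<Rightarrow> 'k ncs) \<Rightarrow> 'k ncs \<Rightarrow> 'k ncs" where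
  "op_subst f F T = Ncs (\<lambda>w. \<Sum>n\<le>length w. of_Q (fps_nth f n) * coeff ((F ^^ n) T) w)"

lemma ad_subst_eq_op_subst: "ad_subst f S = op_subst f (bracket S)"
  by (rule ext) (simp add: ad_subst_def op_subst_def)

lemma funpow_mult_left: "((*) S ^^ n) T = S ^ n * (T :: 'k::comm_ring_1 ncs)"
  by (induction n) (simp_all add: mult.assoc)

lemma subst_eq_op_subst: "subst f S = op_subst f ((*) S) 1"
  by (simp add: subst_def op_subst_def funpow_mult_left)

lemma coeff_op_subst:
  assumes "raising F" "length w \<le> N"
  shows "coeff (op_subst f F T) w = (\<Sum>n\<le>N. of_Q (fps_nth f n) * coeff ((F ^^ n) T) w)"
  unfolding op_subst_def coeff_Ncs
proof (rule sum.mono_neutral_left)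
  show "\<forall>n\<in>{..N} - {..length w}. of_Q (fps_nth f n) * coeff ((F ^^ n) T) w = 0"
    using order_ge_funpow[OF assms(1) order_ge_0[of T]] by (auto simp: order_ge_def)
qed (use assms(2) in auto)

lemma op_subst_approx:
  assumes "raising F"
  shows "order_ge (Suc N) (op_subst f F T - (\<Sum>n\<le>N. scale (of_Q (fps_nth f n)) ((F ^^ n) T)))"
  unfolding order_ge_def by (simp add: coeff_op_subst[OF assms, of _ N] coeff_sum)

text \<open>A map that intertwines \<open>F\<close> and \<open>F'\<close> intertwines the partial
  sums, and continuity carries this over to the limit. The rules for conjugations, twists,
  \<open>deg\<close>, \<open>rquot\<close> and \<open>adh\<close> below are instances.\<close>

lemma op_subst_natural:
  assumes F: "raising F" and F': "raising F'" and G: "continuous_map G"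
    and comm: "\<And>P. G (F P) = F' (G P)"
  shows "G (op_subst f F T) = op_subst f F' (G T)"
proof (rule eq_if_order_ge_diff)
  fix m
  obtain c where c: "\<And>n P. order_ge (n + c) P \<Longrightarrow> order_ge n (G P)"
    using G by (auto simp: continuous_map_def)
  note lin = continuous_map_linear[OF G]
  have pow: "G ((F ^^ n) P) = (F' ^^ n) (G P)" for n P
    by (induction n) (simp_all add: comm)
  \<comment> \<open>Cutting off at \<open>m + c\<close> still leaves order \<open>m\<close> after
    the loss of \<open>c\<close> degrees under \<open>G\<close>.\<close>
  let ?N = "m + c"
  let ?D = "op_subst f F T - (\<Sum>n\<le>?N. scale (of_Q (fps_nth f n)) ((F ^^ n) T))"
  let ?S = "\<Sum>n\<le>?N. scale (of_Q (fps_nth f n)) ((F' ^^ n) (G T))"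
  have "order_ge (m + c) ?D"
    using order_ge_mono[OF op_subst_approx[OF F, of ?N f T]] by simp
  then have "order_ge m (G ?D)" by (rule c)
  moreover have "G ?D = G (op_subst f F T) - ?S"
    by (simp add: linear_map_diff[OF lin] linear_map_sum[OF lin] linear_map_scale[OF lin] pow)
  moreover have "order_ge m (op_subst f F' (G T) - ?S)"
    using order_ge_mono[OF op_subst_approx[OF F', of ?N f "G T"]] by simp
  ultimately have "order_ge m ((G (op_subst f F T) - ?S) - (op_subst f F' (G T) - ?S))"
    by (simp only: order_ge_diff)
  then show "order_ge m (G (op_subst f F T) - op_subst f F' (G T))"
    by (simp add: algebra_simps)
qed

lemma linear_map_op_subst: "linear_map F \<Longrightarrow> linear_map (op_subst f F)"
  unfolding linear_map_def[of "op_subst f F"]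
  by (auto intro!: ncs_eqI simp: op_subst_def linear_map_add[OF linear_map_funpow]
      linear_map_scale[OF linear_map_funpow] algebra_simps sum.distrib sum_distrib_left)

lemma op_subst_add: "op_subst (f + g) F T = op_subst f F T + op_subst g F T"
  and op_subst_const_mult: "op_subst (fps_const c * f) F T = scale (of_Q c) (op_subst f F T)"
  by (auto intro!: ncs_eqI
      simp: op_subst_def of_Q_add of_Q_mult algebra_simps sum.distrib sum_distrib_left)

lemma op_subst_uminus: "op_subst (- f) F T = - op_subst f F T"
  by (auto intro!: ncs_eqI simp: op_subst_def of_Q_uminus sum_negf)

lemma op_subst_diff: "op_subst (f - g) F T = op_subst f F T - op_subst g F T"
  using op_subst_add[of f "- g"] by (simp add: op_subst_uminus)

lemma op_subst_1: "op_subst 1 F T = T"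
proof (rule ncs_eqI)
  fix w
  have "coeff (op_subst 1 F T) w = (\<Sum>n\<le>length w. if n = 0 then coeff T w else 0)"
    unfolding op_subst_def coeff_Ncs by (intro sum.cong) (auto simp: of_Q_0 of_Q_1)
  then show "coeff (op_subst 1 F T) w = coeff T w" by simp
qed

lemma op_subst_X:
  assumes "raising F"
  shows "op_subst fps_X F T = F T"
proof (rule ncs_eqI)
  fix w
  \<comment> \<open>The range is extended by one so that it contains the index 1 even for the empty
    word.\<close>
  have "coeff (op_subst fps_X F T) w = (\<Sum>n\<le>Suc (length w). if n = 1 then coeff (F T) w else 0)"
    unfolding coeff_op_subst[OF assms le_SucI[OF order_refl]]
    by (intro sum.cong) (auto simp: of_Q_0 of_Q_1 fps_X_def)
  then show "coeff (op_subst fps_X F T) w = coeff (F T) w"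
    by (simp del: sum.atMost_Suc)
qed

text \<open>Since \<open>F ^^ (i + j)\<close> raises the order by \<open>i + j\<close>, the square
  of index pairs can be cut down to a triangle, and summing along its diagonals gives the Cauchy
  product.\<close>

lemma op_subst_mult:
  assumes F: "raising F"
  shows "op_subst (f * g) F T = op_subst f F (op_subst g F T)"
proof (rule ncs_eqI)
  fix w :: "letter list"
  let ?n = "length w"
  let ?t = "\<lambda>i j. of_Q (fps_nth f i) * of_Q (fps_nth g j) * coeff ((F ^^ (i + j)) T) w"
  \<comment> \<open>Naturality for the map \<open>F\<close> itself.\<close>
  have comm: "op_subst g F (F P) = F (op_subst g F P)" for P
    by (rule op_subst_natural[OF F F raising_continuous[OF F] refl, symmetric])
  have pow: "(F ^^ i) (op_subst g F T) = op_subst g F ((F ^^ i) T)" for i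
    by (induction i) (simp_all add: comm)
  have add_pow: "(F ^^ j) ((F ^^ i) T) = (F ^^ (i + j)) T" for i j
    unfolding add.commute[of i j] funpow_add by simp
  have "coeff (op_subst f F (op_subst g F T)) w = (\<Sum>i\<le>?n. \<Sum>j\<le>?n. ?t i j)"
    unfolding op_subst_def[of f] coeff_Ncs pow coeff_op_subst[OF F order_refl]
    by (simp add: sum_distrib_left mult.assoc add_pow)
  also have "\<dots> = (\<Sum>(i, j)\<in>{..?n} \<times> {..?n}. ?t i j)"
    by (simp add: sum.cartesian_product)
  also have "\<dots> = (\<Sum>(i, j)\<in>{(i, j). i + j \<le> ?n}. ?t i j)"
  proof (rule sum.mono_neutral_right)
    have "?t i j = 0" if "\<not> i + j \<le> ?n" for i j
      using order_ge_funpow[OF F order_ge_0[of T], of "i + j"] that by (simp add: order_ge_def)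
    then have "(case p of (i, j) \<Rightarrow> ?t i j) = 0" if "p \<notin> {(i, j). i + j \<le> ?n}" for p
      using that by (simp only: case_prod_beta mem_Collect_eq)
    then show "\<forall>p\<in>{..?n} \<times> {..?n} - {(i, j). i + j \<le> ?n}. (case p of (i, j) \<Rightarrow> ?t i j) = 0"
      by blast
  qed auto
  also have "\<dots> = (\<Sum>k\<le>?n. \<Sum>i\<le>k. ?t i (k - i))"
    by (rule sum.triangle_reindex_eq)
  also have "\<dots> = coeff (op_subst (f * g) F T) w"
    by (auto intro!: sum.cong simp: op_subst_def fps_mult_nth of_Q_sum of_Q_mult sum_distrib_right atMost_atLeast0)
  finally show "coeff (op_subst (f * g) F T) w = coeff (op_subst f F (op_subst g F T)) w" ..
qed

lemma op_subst_power:
  "raising F \<Longrightarrow> op_subst (f ^ n) F T = (op_subst f F ^^ n) T"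
  by (induction n) (simp_all add: op_subst_1 op_subst_mult)

text \<open>As \<open>g\<close> has no constant term, \<open>g ^ i\<close> starts in degree
  \<open>i\<close>; hence only \<open>i \<le> k\<close> contributes to the factor of
  \<open>(F ^^ k) T\<close>, which is the coefficient of \<open>f oo g\<close>.\<close>

lemma op_subst_compose:
  assumes F: "raising F" and g: "fps_nth g 0 = 0"
  shows "op_subst (f oo g) F T = op_subst f (op_subst g F) T"
proof (rule ncs_eqI)
  fix w :: "letter list"
  let ?n = "length w"
  let ?t = "\<lambda>i k. of_Q (fps_nth f i) * of_Q (fps_nth (g ^ i) k) * coeff ((F ^^ k) T) w"
  have "coeff (op_subst f (op_subst g F) T) w = (\<Sum>i\<le>?n. \<Sum>k\<le>?n. ?t i k)"
    by (simp add: op_subst_def[of f] op_subst_power[OF F, symmetric] op_subst_def[of "g ^ i" for i]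
        sum_distrib_left mult.assoc)
  also have "\<dots> = (\<Sum>k\<le>?n. \<Sum>i\<le>?n. ?t i k)"
    by (rule sum.swap)
  also have "\<dots> = (\<Sum>k\<le>?n. \<Sum>i\<le>k. ?t i k)"
  proof (rule sum.cong[OF refl], rule sum.mono_neutral_right)
    fix k assume k: "k \<in> {..?n}"
    have "fps_nth (g ^ i) k = 0" if "k < i" for i
      using startsby_zero_power_prefix[OF g] that by blast
    then show "\<forall>i\<in>{..?n} - {..k}. ?t i k = 0" by (auto simp: of_Q_0)
  qed auto
  also have "\<dots> = coeff (op_subst (f oo g) F T) w"
    by (auto intro!: sum.cong simp: op_subst_def fps_compose_nth of_Q_sum of_Q_mult sum_distrib_right
        atMost_atLeast0)
  finally show "coeff (op_subst (f oo g) F T) w = coeff (op_subst f (op_subst g F) T) w" ..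
qed

section \<open>Substitution into power series\<close>

text \<open>Right multiplication by \<open>T\<close> commutes with left multiplication by
  \<open>S\<close>, so naturality applies.\<close>

lemma subst_mult_eq_op_subst:
  assumes "order_ge (Suc 0) S"
  shows "subst f S * T = op_subst f ((*) S) T"
proof -
  have "continuous_map (\<lambda>P. P * T)"
  proof (rule continuous_mapI[where c = 0])
    show "linear_map (\<lambda>P. P * T)"
      by (simp add: linear_map_def distrib_right scale_mult_left)
    show "order_ge n (P * T)" if "order_ge (n + 0) P" for n P
      using order_ge_mult[OF that order_ge_0[of T]] by simp
  qed
  then have "op_subst f ((*) S) 1 * T = op_subst f ((*) S) (1 * T)"
    by (rule op_subst_natural[OF raising_mult_left[OF assms] raising_mult_left[OF assms]])
      (rule mult.assoc)
  then show ?thesis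
    by (simp add: subst_eq_op_subst)
qed

lemma subst_mult:
  "order_ge (Suc 0) S \<Longrightarrow> subst (f * g) S = subst f S * subst g S"
  by (simp add: subst_mult_eq_op_subst)
    (simp add: subst_eq_op_subst op_subst_mult raising_mult_left)

lemma subst_add: "subst (f + g) S = subst f S + subst g S"
  and subst_diff: "subst (f - g) S = subst f S - subst g S"
  and subst_uminus: "subst (- f) S = - subst f S"
  and subst_1: "subst 1 S = 1"
  and subst_const_mult: "subst (fps_const c * f) S = scale (of_Q c) (subst f S)"
  by (simp_all add: subst_eq_op_subst op_subst_add op_subst_diff op_subst_uminus op_subst_1
      op_subst_const_mult)

lemma subst_X: "order_ge (Suc 0) S \<Longrightarrow> subst fps_X S = S"
  by (simp add: subst_eq_op_subst op_subst_X raising_mult_left)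

lemma subst_compose:
  assumes "order_ge (Suc 0) S" "fps_nth g 0 = 0"
  shows "subst (f oo g) S = subst f (subst g S)"
proof -
  have "op_subst g ((*) S) = (*) (subst g S)"
    by (rule ext) (simp add: subst_mult_eq_op_subst assms)
  then show ?thesis
    using assms by (simp add: subst_eq_op_subst op_subst_compose raising_mult_left)
qed

lemma coeff_subst_Nil: "coeff (subst f S) [] = of_Q (fps_nth f 0)"
  by (simp add: subst_def coeff_1)

lemma subst_minus:
  assumes "order_ge (Suc 0) S"
  shows "subst f (- S) = subst (f oo - fps_X) S"
  using assms by (simp add: subst_compose subst_uminus subst_X)

lemma subst_conjugate:
  assumes S: "order_ge (Suc 0) S" and Q: "Q' * Q = 1" "Q * Q' = 1"
  shows "subst f (Q * S * Q') = Q * subst f S * Q'"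
proof -
  have S': "order_ge (Suc 0) (Q * S * Q')"
    using order_ge_mult[OF order_ge_mult[OF order_ge_0[of Q] S] order_ge_0[of Q']] by simp
  have "continuous_map (\<lambda>P. Q * P * Q')"
  proof (rule continuous_mapI[where c = 0])
    show "linear_map (\<lambda>P. Q * P * Q')"
      by (simp add: linear_map_def distrib_right distrib_left scale_mult_left scale_mult_right)
    show "order_ge n (Q * P * Q')" if "order_ge (n + 0) P" for n P
      using order_ge_mult[OF order_ge_mult[OF order_ge_0[of Q] that] order_ge_0[of Q']] by simp
  qed
  moreover have comm: "Q * (S * P) * Q' = Q * S * Q' * (Q * P * Q')" for P
  proof -
    have "Q * S * Q' * (Q * P * Q') = Q * S * (Q' * Q) * P * Q'"
      by (simp only: mult.assoc)
    then show ?thesis by (simp only: Q mult.assoc mult_1_left)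
  qed
  ultimately have "Q * op_subst f ((*) S) 1 * Q' = op_subst f ((*) (Q * S * Q')) (Q * 1 * Q')"
    by (intro op_subst_natural[OF raising_mult_left[OF S] raising_mult_left[OF S']]) auto
  then show ?thesis
    by (simp add: subst_eq_op_subst Q)
qed

section \<open>Twists by multiplicative functions of words\<close>

text \<open>For multiplicative \<open>c\<close> this is a continuous algebra endomorphism that
  rescales the letters. It serves both for changing the sign of the letters and for setting a letter
  to \<open>0\<close>.\<close>

definition twist :: "(letter list \<Rightarrow> 'k) \<Rightarrow> 'k::comm_ring_1 ncs \<Rightarrow> 'k ncs" where
  "twist c P = Ncs (\<lambda>w. c w * coeff P w)"

lemma coeff_twist [simp]: "coeff (twist c P) w = c w * coeff P w"
  by (simp add: twist_def)

lemma linear_map_twist: "linear_map (twist c)"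
  unfolding linear_map_def by (auto intro!: ncs_eqI simp: algebra_simps)

lemma order_ge_twist: "order_ge n P \<Longrightarrow> order_ge n (twist c P)"
  by (simp add: order_ge_def)

lemma continuous_twist: "continuous_map (twist c)"
  by (rule continuous_mapI[where c = 0]) (auto intro: linear_map_twist order_ge_twist)

locale multiplicative =
  fixes c :: "letter list \<Rightarrow> 'k::comm_rat_algebra"
  assumes Nil: "c [] = 1" and append: "c (u @ v) = c u * c v"
begin

lemma twist_mult: "twist c (P * Q) = twist c P * twist c Q"
proof (rule ncs_eqI)
  fix w
  have split: "c w = c (take i w) * c (drop i w)" for i
    using append[of "take i w" "drop i w"] by simp
  have "c w * (coeff P (take i w) * coeff Q (drop i w)) =
      c (take i w) * coeff P (take i w) * (c (drop i w) * coeff Q (drop i w))" for i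
    by (subst split[of i]) (simp only: ac_simps)
  then show "coeff (twist c (P * Q)) w = coeff (twist c P * twist c Q) w"
    by (simp add: coeff_mult sum_distrib_left)
qed

lemma twist_1: "twist c 1 = 1"
  by (rule ncs_eqI) (simp add: coeff_1 Nil)

lemma twist_bracket: "twist c (bracket P Q) = bracket (twist c P) (twist c Q)"
  by (simp add: bracket_def linear_map_diff[OF linear_map_twist] twist_mult)

lemma twist_subst:
  assumes "order_ge (Suc 0) S"
  shows "twist c (subst f S) = subst f (twist c S)"
proof -
  have "twist c (op_subst f ((*) S) 1) = op_subst f ((*) (twist c S)) (twist c 1)"
    by (rule op_subst_natural[OF raising_mult_left[OF assms]
          raising_mult_left[OF order_ge_twist[OF assms]] continuous_twist]) (rule twist_mult)
  then show ?thesis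
    by (simp only: subst_eq_op_subst twist_1)
qed

lemma twist_ad_subst:
  assumes "order_ge (Suc 0) S"
  shows "twist c (ad_subst f S T) = ad_subst f (twist c S) (twist c T)"
  unfolding ad_subst_eq_op_subst
  by (rule op_subst_natural[OF raising_bracket[OF assms]
      raising_bracket[OF order_ge_twist[OF assms]] continuous_twist]) (rule twist_bracket)

end

section \<open>Exponential and logarithm\<close>

text \<open>The series \<open>(e^u - 1)/u\<close>.\<close>

definition exp_quot :: "rat fps" where
  "exp_quot = fps_shift 1 (fps_exp 1)"

text \<open>The series \<open>log (1 + u)/u\<close>.\<close>

definition ln_quot :: "rat fps" where
  "ln_quot = fps_shift 1 (fps_ln 1)"

lemma exp_quot_mult_X: "exp_quot * fps_X = fps_exp 1 - 1"
  by (rule fps_ext) (simp add: exp_quot_def)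

lemma ln_quot_mult_X: "ln_quot * fps_X = fps_ln 1"
  by (rule fps_ext) (simp add: ln_quot_def fps_ln_nth)

lemma ln_compose_exp: "fps_ln 1 oo (fps_exp 1 - 1) = (fps_X :: rat fps)"
  by (simp add: fps_ln_fps_exp_inv fps_inv)

lemma exp_compose_ln: "fps_exp 1 oo fps_ln 1 = (1 + fps_X :: rat fps)"
proof -
  have "(fps_exp 1 - 1) oo fps_ln 1 = (fps_X :: rat fps)"
    by (simp add: fps_ln_fps_exp_inv fps_inv_right)
  then show ?thesis
    by (simp add: fps_compose_sub_distrib diff_eq_eq add.commute)
qed

text \<open>With \<open>v = e^u - 1\<close> the two factors are \<open>u/v\<close> and
  \<open>v/u\<close>. In \<open>Dynkin_BCH\<close> this undoes the factor that comes from
  differentiating an exponential.\<close>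

lemma ln_quot_compose_exp_mult: "(ln_quot oo (fps_exp 1 - 1)) * exp_quot = 1"
proof -
  have "(ln_quot oo (fps_exp 1 - 1)) * exp_quot * fps_X =
      (ln_quot oo (fps_exp 1 - 1)) * (fps_X oo (fps_exp 1 - 1))"
    by (simp add: mult.assoc exp_quot_mult_X)
  also have "\<dots> = (ln_quot * fps_X) oo (fps_exp 1 - 1)"
    by (simp add: fps_compose_mult_distrib)
  also have "\<dots> = 1 * fps_X"
    by (simp add: ln_quot_mult_X ln_compose_exp)
  finally show ?thesis
    by (metis fps_X_neq_zero mult_right_cancel)
qed

lemma exp_compose_uminus: "fps_exp 1 oo - fps_X = (fps_exp (- 1) :: rat fps)"
  using fps_exp_compose_linear[of 1 "- 1 :: rat"] by simp

lemma coeff_nc_exp_Nil: "coeff (nc_exp S) [] = 1"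
  by (simp add: nc_exp_def coeff_subst_Nil of_Q_1)

lemma nc_exp_mult_uminus:
  assumes "order_ge (Suc 0) S"
  shows "nc_exp S * nc_exp (- S) = 1"
proof -
  have "fps_exp 1 * fps_exp (- 1) = (1 :: rat fps)"
    by (simp flip: fps_exp_add_mult)
  then show ?thesis
    using assms by (simp add: nc_exp_def subst_minus exp_compose_uminus subst_1 flip: subst_mult)
qed

lemma nc_exp_uminus_mult:
  "order_ge (Suc 0) S \<Longrightarrow> nc_exp (- S) * nc_exp S = 1"
  using nc_exp_mult_uminus[of "- S"] by (simp add: order_ge_uminus)

lemma nc_log_exp:
  assumes "order_ge (Suc 0) S"
  shows "nc_log (nc_exp S) = S"
proof -
  have "nc_log (nc_exp S) = subst (fps_ln 1 oo (fps_exp 1 - 1)) S"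
    using assms by (simp add: nc_log_def nc_exp_def subst_compose subst_diff subst_1)
  then show ?thesis
    using assms by (simp add: ln_compose_exp subst_X)
qed

lemma nc_exp_log:
  assumes "coeff G [] = 1"
  shows "nc_exp (nc_log G) = G"
proof -
  have "order_ge (Suc 0) (G - 1)"
    using assms by (simp add: order_ge_coeff_Nil coeff_1)
  then have "nc_exp (nc_log G) = subst (fps_exp 1 oo fps_ln 1) (G - 1)"
    by (simp add: nc_log_def nc_exp_def subst_compose fps_ln_nth)
  also have "\<dots> = G"
    using \<open>order_ge (Suc 0) (G - 1)\<close> by (simp add: exp_compose_ln subst_add subst_1 subst_X)
  finally show ?thesis .
qed

lemma order_ge_nc_log: "order_ge (Suc 0) (nc_log G)"
  by (simp add: order_ge_coeff_Nil nc_log_def coeff_subst_Nil fps_ln_nth of_Q_0)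

lemma nc_log_conjugate:
  assumes "coeff G [] = 1" "Q' * Q = 1" "Q * Q' = 1"
  shows "nc_log (Q * G * Q') = Q * nc_log G * Q'"
proof -
  have "order_ge (Suc 0) (G - 1)"
    using assms(1) by (simp add: order_ge_coeff_Nil coeff_1)
  moreover have "Q * G * Q' - 1 = Q * (G - 1) * Q'"
    by (simp add: algebra_simps assms)
  ultimately show ?thesis
    using assms(2,3) by (simp add: nc_log_def subst_conjugate)
qed

section \<open>Sums of sequences of increasing order\<close>

text \<open>The infinite sum of the \<open>T n\<close>, meant for \<open>T n\<close> of order at
  least \<open>n\<close>, where the cut at \<open>length w\<close> loses nothing.\<close>

definition ser :: "(nat \<Rightarrow> 'k::comm_ring_1 ncs) \<Rightarrow> 'k ncs" where
  "ser T = Ncs (\<lambda>w. \<Sum>n\<le>length w. coeff (T n) w)"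

lemma coeff_ser:
  assumes "\<And>n. order_ge n (T n)" "length w \<le> N"
  shows "coeff (ser T) w = (\<Sum>n\<le>N. coeff (T n) w)"
  unfolding ser_def coeff_Ncs
proof (rule sum.mono_neutral_left)
  show "\<forall>n\<in>{..N} - {..length w}. coeff (T n) w = 0"
    using assms(1) by (auto simp: order_ge_def)
qed (use assms(2) in auto)

lemma ser_mult:
  assumes T: "\<And>n. order_ge n (T n)" and U: "\<And>n. order_ge n (U n)"
  shows "ser T * ser U = ser (\<lambda>n. \<Sum>k\<le>n. T k * U (n - k))"
proof (rule ncs_eqI)
  fix w :: "letter list"
  let ?N = "length w"
  have "coeff (ser T * ser U) w =
      (\<Sum>i\<le>?N. \<Sum>k\<le>?N. \<Sum>m\<le>?N. coeff (T k) (take i w) * coeff (U m) (drop i w))"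
    unfolding coeff_mult
    by (intro sum.cong refl) (simp add: coeff_ser[OF T, of _ ?N] coeff_ser[OF U, of _ ?N] sum_product)
  also have "\<dots> = (\<Sum>k\<le>?N. \<Sum>i\<le>?N. \<Sum>m\<le>?N. coeff (T k) (take i w) * coeff (U m) (drop i w))"
    by (rule sum.swap)
  also have "\<dots> = (\<Sum>k\<le>?N. \<Sum>m\<le>?N. coeff (T k * U m) w)"
    unfolding coeff_mult by (intro sum.cong refl sum.swap)
  also have "\<dots> = (\<Sum>(k, m)\<in>{..?N} \<times> {..?N}. coeff (T k * U m) w)"
    by (simp add: sum.cartesian_product)
  also have "\<dots> = (\<Sum>(k, m)\<in>{(k, m). k + m \<le> ?N}. coeff (T k * U m) w)"
  proof (rule sum.mono_neutral_right)
    have "coeff (T k * U m) w = 0" if "\<not> k + m \<le> ?N" for k m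
      using order_ge_mult[OF T[of k] U[of m]] that by (simp add: order_ge_def)
    then have "(case p of (k, m) \<Rightarrow> coeff (T k * U m) w) = 0" if "p \<notin> {(k, m). k + m \<le> ?N}" for p
      using that by (simp only: case_prod_beta mem_Collect_eq)
    then show "\<forall>p\<in>{..?N} \<times> {..?N} - {(k, m). k + m \<le> ?N}.
        (case p of (k, m) \<Rightarrow> coeff (T k * U m) w) = 0"
      by blast
  qed auto
  also have "\<dots> = (\<Sum>n\<le>?N. \<Sum>k\<le>n. coeff (T k * U (n - k)) w)"
    by (rule sum.triangle_reindex_eq)
  also have "\<dots> = coeff (ser (\<lambda>n. \<Sum>k\<le>n. T k * U (n - k))) w"
    by (simp add: ser_def coeff_sum)
  finally show "coeff (ser T * ser U) w = coeff (ser (\<lambda>n. \<Sum>k\<le>n. T k * U (n - k))) w" .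
qed

text \<open>With \<open>C = 0\<close> this expands \<open>S\<^sup>n * T\<^sub>0\<close>, and with \<open>T\<^sub>0 = 0\<close> it expands the derivation
  \<open>S \<mapsto> C\<close> applied to \<open>S\<^sup>n\<close>.\<close>

lemma binomial_expansion:
  assumes T: "\<And>k. T (Suc k) = bracket S (T k) + (if k = 0 then C else 0)"
    and U0: "U 0 = T 0" and U: "\<And>n. U (Suc n) = S * U n + C * S ^ n"
  shows "U n = (\<Sum>k\<le>n. scale (of_nat (n choose k)) (T k * S ^ (n - k)))"
proof (induction n)
  case 0
  then show ?case by (simp add: U0)
next
  case (Suc n)
  let ?b = "\<lambda>n k. of_nat (n choose k)"
  have ST: "S * T k = T (Suc k) - (if k = 0 then C else 0) + T k * S" for k
    by (simp add: T bracket_def)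
  have "S * U n = (\<Sum>k\<le>n. scale (?b n k) (S * T k * S ^ (n - k)))"
    by (simp add: Suc sum_distrib_left scale_mult_right mult.assoc)
  also have "\<dots> = (\<Sum>k\<le>n. scale (?b n k) (T (Suc k) * S ^ (n - k))) +
      (\<Sum>k\<le>n. scale (?b n k) (T k * S * S ^ (n - k))) -
      (\<Sum>k\<le>n. if k = 0 then C * S ^ n else 0)"
    unfolding ST sum.distrib[symmetric] sum_subtractf[symmetric]
    by (intro sum.cong refl) (simp add: algebra_simps scale_add scale_diff)
  also have "(\<Sum>k\<le>n. if k = 0 then C * S ^ n else 0) = C * S ^ n"
    by simp
  \<comment> \<open>The added term \<open>k = n + 1\<close> has binomial coefficient
    \<open>0\<close>. Splitting off \<open>k = 0\<close> afterwards aligns the two sums for Pascal's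
    rule.\<close>
  also have "(\<Sum>k\<le>n. scale (?b n k) (T k * S * S ^ (n - k))) =
      (\<Sum>k\<le>Suc n. scale (?b n k) (T k * S ^ (Suc n - k)))"
    by (simp add: mult.assoc Suc_diff_le binomial_eq_0 flip: power_Suc)
  also have "\<dots> = T 0 * S ^ Suc n + (\<Sum>k\<le>n. scale (?b n (Suc k)) (T (Suc k) * S ^ (n - k)))"
    by (subst sum.atMost_Suc_shift) simp
  finally have "U (Suc n) = T 0 * S ^ Suc n +
      (\<Sum>k\<le>n. scale (?b (Suc n) (Suc k)) (T (Suc k) * S ^ (n - k)))"
    by (simp add: U scale_plus sum.distrib algebra_simps)
  also have "\<dots> = (\<Sum>k\<le>Suc n. scale (?b (Suc n) k) (T k * S ^ (Suc n - k)))"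
    by (subst sum.atMost_Suc_shift) simp
  finally show ?case .
qed

text \<open>Divided by \<open>n!\<close> and summed over \<open>n\<close>, the binomial expansion
  becomes a Cauchy product with \<open>nc_exp S\<close>.\<close>

lemma exponential_expansion:
  fixes S :: "'k::comm_rat_algebra ncs"
  assumes T: "\<And>k. T (Suc k) = bracket S (T k) + (if k = 0 then C else 0)"
    and U0: "U 0 = T 0" and U: "\<And>n. U (Suc n) = S * U n + C * S ^ n"
    and S: "order_ge (Suc 0) S" and ord: "\<And>k. order_ge k (T k)"
  shows "ser (\<lambda>n. scale (of_Q (1 / fact n)) (U n)) =
    ser (\<lambda>n. scale (of_Q (1 / fact n)) (T n)) * nc_exp S"
proof -
  have pow: "order_ge n (S ^ n)" for n
  proof (induction n)
    case (Suc n)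
    then show ?case using order_ge_mult[OF S] by simp
  qed simp
  have "nc_exp S = ser (\<lambda>n. scale (of_Q (1 / fact n)) (S ^ n))"
    by (simp add: nc_exp_def subst_def ser_def)
  then have "ser (\<lambda>n. scale (of_Q (1 / fact n)) (T n)) * nc_exp S =
      ser (\<lambda>n. \<Sum>k\<le>n. scale (of_Q (1 / fact k)) (T k) * scale (of_Q (1 / fact (n - k))) (S ^ (n - k)))"
    by (simp add: ser_mult order_ge_scale ord pow)
  also have "\<dots> = ser (\<lambda>n. scale (of_Q (1 / fact n)) (U n))"
  proof (intro arg_cong[where f = ser] ext)
    fix n
    have fact: "of_Q (1 / fact (n - k)) * of_Q (1 / fact k) =
        (of_Q (1 / fact n) * of_nat (n choose k) :: 'k)" if "k \<le> n" for k
    proof -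
      have "1 / fact (n - k) * (1 / fact k) = 1 / fact n * (of_nat (n choose k) :: rat)"
        using that by (simp add: binomial_fact)
      then show ?thesis
        by (metis of_Q_mult of_Q_of_nat)
    qed
    show "(\<Sum>k\<le>n. scale (of_Q (1 / fact k)) (T k) * scale (of_Q (1 / fact (n - k))) (S ^ (n - k))) =
        scale (of_Q (1 / fact n)) (U n)"
      unfolding binomial_expansion[OF T U0 U]
      by (auto intro!: ncs_eqI sum.cong
          simp: scale_mult_left scale_mult_right scale_scale coeff_sum sum_distrib_left fact
          simp flip: mult.assoc)
  qed
  finally show ?thesis ..
qed

text \<open>The expansion with \<open>C = 0\<close>, where the left hand terms are
  \<open>S ^ n * T\<close> and the right hand terms are iterated brackets.\<close>

lemma nc_exp_mult_eq_ad:
  assumes "order_ge (Suc 0) S"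
  shows "nc_exp S * T = ad_subst (fps_exp 1) S T * nc_exp S"
proof -
  have "ser (\<lambda>n. scale (of_Q (1 / fact n)) (S ^ n * T)) =
      ser (\<lambda>n. scale (of_Q (1 / fact n)) ((bracket S ^^ n) T)) * nc_exp S"
  proof (rule exponential_expansion[where C = 0])
    show "order_ge k ((bracket S ^^ k) T)" for k
      using order_ge_funpow[OF raising_bracket[OF assms] order_ge_0[of T]] by simp
  qed (simp_all add: assms mult.assoc)
  moreover have "nc_exp S * T = ser (\<lambda>n. scale (of_Q (1 / fact n)) (S ^ n * T))"
    using assms
    by (simp add: nc_exp_def subst_mult_eq_op_subst op_subst_def ser_def funpow_mult_left)
  ultimately show ?thesis
    by (simp add: ad_subst_def ser_def)
qed

lemma ad_exp:
  assumes "order_ge (Suc 0) S"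
  shows "ad_subst (fps_exp 1) S T = nc_exp S * T * nc_exp (- S)"
proof -
  have "nc_exp S * T * nc_exp (- S) = ad_subst (fps_exp 1) S T * (nc_exp S * nc_exp (- S))"
    by (simp only: nc_exp_mult_eq_ad[OF assms, of T] mult.assoc)
  then show ?thesis
    by (simp add: nc_exp_mult_uminus[OF assms])
qed

section \<open>Degree derivations\<close>

definition deg :: "letter \<Rightarrow> 'k::comm_ring_1 ncs \<Rightarrow> 'k ncs" where
  "deg v P = Ncs (\<lambda>w. of_nat (count_list w v) * coeff P w)"

lemma coeff_deg [simp]: "coeff (deg v P) w = of_nat (count_list w v) * coeff P w"
  by (simp add: deg_def)

lemma linear_map_deg: "linear_map (deg v)"
  unfolding linear_map_def by (auto intro!: ncs_eqI simp: algebra_simps)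

lemma order_ge_deg: "order_ge n P \<Longrightarrow> order_ge n (deg v P)"
  by (simp add: order_ge_def)

lemma continuous_deg: "continuous_map (deg v)"
  by (rule continuous_mapI[where c = 0]) (auto intro: linear_map_deg order_ge_deg)

lemma deg_mult: "deg v (P * Q) = deg v P * Q + P * deg v Q"
proof (rule ncs_eqI)
  fix w
  have split: "(of_nat (count_list w v) :: 'a) =
      of_nat (count_list (take i w) v) + of_nat (count_list (drop i w) v)" for i
    by (metis append_take_drop_id count_list_append of_nat_add)
  have "of_nat (count_list w v) * (coeff P (take i w) * coeff Q (drop i w)) =
      of_nat (count_list (take i w) v) * coeff P (take i w) * coeff Q (drop i w) +
      coeff P (take i w) * (of_nat (count_list (drop i w) v) * coeff Q (drop i w))" for i
    by (subst split[of i]) (simp only: algebra_simps)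
  then show "coeff (deg v (P * Q)) w = coeff (deg v P * Q + P * deg v Q) w"
    by (simp add: coeff_mult sum_distrib_left sum.distrib)
qed

lemma deg_1: "deg v 1 = 0"
  by (rule ncs_eqI) (simp add: coeff_1)

lemma deg_var: "deg v (var x) = (if x = v then var x else 0)"
  by (rule ncs_eqI) (auto simp: coeff_monom)

lemma deg_bracket: "deg v (bracket P Q) = bracket (deg v P) Q + bracket P (deg v Q)"
  by (simp add: bracket_def linear_map_diff[OF linear_map_deg] deg_mult)

lemma deg_ad_subst:
  assumes S: "order_ge (Suc 0) S" and "deg v S = 0"
  shows "deg v (ad_subst f S T) = ad_subst f S (deg v T)"
  unfolding ad_subst_eq_op_subst
proof (rule op_subst_natural[OF raising_bracket[OF S] raising_bracket[OF S] continuous_deg])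
  show "deg v (bracket S P) = bracket S (deg v P)" for P
    using assms(2) by (simp add: deg_bracket) (simp add: bracket_def)
qed

text \<open>The derivative of the exponential for the derivation \<open>deg v\<close>: the expansion
  with \<open>C = deg v S\<close> and initial term \<open>0\<close>.\<close>

lemma deg_nc_exp:
  assumes S: "order_ge (Suc 0) S"
  shows "deg v (nc_exp S) = ad_subst exp_quot S (deg v S) * nc_exp S"
proof -
  \<comment> \<open>The \<open>k\<close>-th iterated bracket stands at index \<open>k + 1\<close>
    and so receives \<open>1/(k + 1)!\<close>, the coefficient of \<open>u^k\<close> in
    \<open>exp_quot\<close>.\<close>
  define T where "T n = (case n of 0 \<Rightarrow> 0 | Suc k \<Rightarrow> (bracket S ^^ k) (deg v S))" for n
  have ord: "order_ge k (T k)" for k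
    using order_ge_funpow[OF raising_bracket[OF S] order_ge_deg[OF S]]
    by (cases k) (simp_all add: T_def)
  have "ser (\<lambda>n. scale (of_Q (1 / fact n)) (deg v (S ^ n))) =
      ser (\<lambda>n. scale (of_Q (1 / fact n)) (T n)) * nc_exp S"
  proof (rule exponential_expansion[where C = "deg v S", OF _ _ _ S ord])
    show "T (Suc k) = bracket S (T k) + (if k = 0 then deg v S else 0)" for k
      by (cases k) (simp_all add: T_def bracket_def)
  qed (simp_all add: T_def deg_1 deg_mult add.commute)
  moreover have "deg v (nc_exp S) = ser (\<lambda>n. scale (of_Q (1 / fact n)) (deg v (S ^ n)))"
    by (rule ncs_eqI) (simp add: nc_exp_def subst_def ser_def sum_distrib_left mult.left_commute)
  moreover have "ser (\<lambda>n. scale (of_Q (1 / fact n)) (T n)) = ad_subst exp_quot S (deg v S)"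
  proof (rule ncs_eqI)
    fix w :: "letter list"
    have "coeff (ser (\<lambda>n. scale (of_Q (1 / fact n)) (T n))) w =
        (\<Sum>n\<le>Suc (length w). coeff (scale (of_Q (1 / fact n)) (T n)) w)"
      by (rule coeff_ser) (simp_all add: order_ge_scale ord)
    also have "\<dots> = coeff (ad_subst exp_quot S (deg v S)) w"
      by (subst sum.atMost_Suc_shift) (simp add: T_def ad_subst_def exp_quot_def algebra_simps)
    finally show "coeff (ser (\<lambda>n. scale (of_Q (1 / fact n)) (T n))) w =
        coeff (ad_subst exp_quot S (deg v S)) w" .
  qed
  ultimately show ?thesis by simp
qed

section \<open>The Baker-Campbell-Hausdorff series\<close>

lemma coeff_mult_Nil: "coeff (P * Q) [] = coeff P [] * coeff Q []"
  by (simp add: coeff_mult)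

lemma order_ge_BCH: "order_ge (Suc 0) (BCH S T)"
  by (simp add: BCH_def order_ge_nc_log)

lemma nc_exp_BCH: "nc_exp (BCH S T) = nc_exp S * nc_exp T"
  by (simp add: BCH_def nc_exp_log coeff_mult_Nil coeff_nc_exp_Nil)

text \<open>One has \<open>e^T e^S = e^T (e^S e^T) e^(-T)\<close>, and the logarithm commutes with
  conjugation.\<close>

lemma BCH_conjugate:
  assumes "order_ge (Suc 0) T"
  shows "BCH T S = nc_exp T * BCH S T * nc_exp (- T)"
proof -
  have "nc_exp T * nc_exp S = nc_exp T * (nc_exp S * nc_exp T) * nc_exp (- T)"
    by (simp add: mult.assoc nc_exp_mult_uminus[OF assms])
  then show ?thesis
    unfolding BCH_def
    by (simp add: nc_log_conjugate coeff_mult_Nil coeff_nc_exp_Nil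
        nc_exp_mult_uminus[OF assms] nc_exp_uminus_mult[OF assms])
qed

lemma nc_exp_uminus_BCH:
  assumes S: "order_ge (Suc 0) S" and T: "order_ge (Suc 0) T"
  shows "nc_exp (- BCH S T) = nc_exp (- T) * nc_exp (- S)"
proof -
  have inv: "nc_exp S * nc_exp T * (nc_exp (- T) * nc_exp (- S)) = 1"
  proof -
    have "nc_exp S * nc_exp T * (nc_exp (- T) * nc_exp (- S)) =
        nc_exp S * (nc_exp T * nc_exp (- T)) * nc_exp (- S)"
      by (simp only: mult.assoc)
    then show ?thesis by (simp add: nc_exp_mult_uminus S T)
  qed
  have "nc_exp (- BCH S T) = nc_exp (- BCH S T) * nc_exp (BCH S T) * (nc_exp (- T) * nc_exp (- S))"
    using inv by (simp add: nc_exp_BCH mult.assoc)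
  then show ?thesis
    by (simp add: nc_exp_uminus_mult[OF order_ge_BCH])
qed

text \<open>The product \<open>e^(-S) e^(-T)\<close> is the inverse of \<open>e^T e^S\<close>, hence
  the exponential of \<open>- BCH T S\<close>.\<close>

lemma BCH_uminus:
  assumes "order_ge (Suc 0) S" "order_ge (Suc 0) T"
  shows "BCH (- S) (- T) = - BCH T S"
proof -
  have "BCH (- S) (- T) = nc_log (nc_exp (- BCH T S))"
    by (simp add: nc_exp_uminus_BCH assms) (simp add: BCH_def)
  then show ?thesis
    by (simp add: nc_log_exp order_ge_uminus order_ge_BCH)
qed

lemma (in multiplicative) twist_BCH:
  assumes S: "order_ge (Suc 0) S" and T: "order_ge (Suc 0) T"
  shows "twist c (BCH S T) = BCH (twist c S) (twist c T)"
proof -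
  have "order_ge (Suc 0) (nc_exp S * nc_exp T - 1)"
    by (simp add: order_ge_coeff_Nil coeff_mult_Nil coeff_nc_exp_Nil coeff_1)
  then show ?thesis
    using assms
    by (simp add: BCH_def nc_log_def twist_subst linear_map_diff[OF linear_map_twist] twist_mult
        twist_1) (simp add: nc_exp_def twist_subst)
qed

section \<open>Parity\<close>

abbreviation sign :: "letter list \<Rightarrow> 'k::comm_rat_algebra" where
  "sign w \<equiv> (- 1) ^ length w"

lemma multiplicative_sign: "multiplicative sign"
  by unfold_locales (simp_all add: power_add)

lemma twist_sign_var: "twist sign (var v) = - var v"
  by (rule ncs_eqI) (simp add: coeff_monom)

lemma half_mult_double: "of_Q (1/2) * (2 * x) = (x :: 'k::comm_rat_algebra)"
proof -
  have "of_Q (1/2) * (2 * x) = (of_Q (1/2) + of_Q (1/2)) * x"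
    by (simp add: algebra_simps)
  then show ?thesis
    by (simp add: of_Q_1 flip: of_Q_add)
qed

lemma even_part_eq: "even_part P = scale (of_Q (1/2)) (P + twist sign P)"
  by (rule ncs_eqI) (simp add: even_part_def half_mult_double)

lemma odd_part_eq: "odd_part P = scale (of_Q (1/2)) (P - twist sign P)"
  by (rule ncs_eqI) (simp add: odd_part_def half_mult_double)

lemma linear_map_odd_part: "linear_map odd_part"
  and linear_map_even_part: "linear_map even_part"
  unfolding linear_map_def by (auto intro!: ncs_eqI simp: odd_part_def even_part_def)

lemma twist_sign_BCH: "twist sign (BCH (var a) (var b)) = - BCH (var b) (var a)"
  by (simp add: multiplicative.twist_BCH[OF multiplicative_sign] order_ge_var twist_sign_var
      BCH_uminus)

lemma even_part_BCH:
  "even_part (BCH (var a) (var b)) =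
    scale (of_Q (1/2)) (BCH (var a) (var b) - BCH (var b) (var a))"
  and odd_part_BCH:
  "odd_part (BCH (var a) (var b)) =
    scale (of_Q (1/2)) (BCH (var a) (var b) + BCH (var b) (var a))"
  by (simp_all add: even_part_eq odd_part_eq twist_sign_BCH)

lemma even_part_var: "even_part (var v) = 0"
  and odd_part_var: "odd_part (var v) = var v"
  by (auto intro!: ncs_eqI simp: even_part_def odd_part_def coeff_monom)

section \<open>The power series \<beta> and \<eta>\<close>

lemma exp_minus_1_nonzero: "fps_exp 1 - 1 \<noteq> (0 :: rat fps)"
proof
  assume "fps_exp 1 - 1 = (0 :: rat fps)"
  then have "fps_nth (fps_exp 1 - 1 :: rat fps) 1 = 0" by simp
  then show False by simp
qed

lemma beta_mult: "beta * (fps_exp 1 - 1) = fps_X"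
proof -
  have "subdegree (fps_exp 1 - 1 :: rat fps) = 1"
    by (rule subdegreeI) auto
  then have "fps_exp 1 - 1 dvd (fps_X :: rat fps)"
    by (simp add: fps_dvd_iff exp_minus_1_nonzero)
  then show ?thesis
    unfolding beta_def by (rule dvd_div_mult_self)
qed

text \<open>The identity \<open>\<eta>(u) = (u/2) (e^u + 1)/(e^u - 1)\<close> without
  denominators.\<close>

lemma eta_mult: "eta * (fps_exp 1 - 1) = fps_const (1/2) * fps_X * (fps_exp 1 + 1)"
proof -
  have "fps_const (1/2) + fps_const (1/2) = (1 :: rat fps)"
    by (simp flip: fps_const_1_eq_1)
  then have "fps_X = (fps_const (1/2) + fps_const (1/2)) * (fps_X :: rat fps)"
    by simp
  then show ?thesis
    unfolding eta_def distrib_right beta_mult by (simp add: algebra_simps)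
qed

lemma eta_even: "eta oo - fps_X = eta"
proof -
  let ?E = "fps_exp 1 :: rat fps" and ?E' = "fps_exp (- 1) :: rat fps"
  have inv: "?E * ?E' = 1"
    by (simp flip: fps_exp_add_mult)
  have "(eta oo - fps_X) * (?E' - 1) = (eta * (?E - 1)) oo - fps_X"
    by (simp add: fps_compose_mult_distrib fps_compose_sub_distrib exp_compose_uminus)
  also have "\<dots> = - (fps_const (1/2) * fps_X * (?E' + 1))"
    unfolding eta_mult
    by (simp add: fps_compose_mult_distrib fps_compose_add_distrib exp_compose_uminus)
  finally have eq: "(eta oo - fps_X) * (?E' - 1) * ?E = - (fps_const (1/2) * fps_X * (?E' + 1)) * ?E"
    by simp
  \<comment> \<open>Multiplication by \<open>e^u\<close> turns \<open>e^(-u) - 1\<close> into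
    \<open>-(e^u - 1)\<close>, which leads back to the relation that determines
    \<open>eta\<close>.\<close>
  have "(eta oo - fps_X) * (?E - 1) = - ((eta oo - fps_X) * (?E' - 1) * ?E)"
    using inv by (simp add: algebra_simps)
  also have "\<dots> = fps_const (1/2) * fps_X * (?E + 1)"
    unfolding eq using inv by (simp add: algebra_simps)
  also have "\<dots> = eta * (?E - 1)"
    by (simp add: eta_mult)
  finally show ?thesis
    using exp_minus_1_nonzero by simp
qed

section \<open>The explicit solution\<close>

lemma op_subst_annihilated:
  assumes "F T = 0" "F 0 = 0"
  shows "op_subst f F T = scale (of_Q (fps_nth f 0)) T"
proof (rule ncs_eqI)
  fix w
  have "(F ^^ Suc n) T = 0" for n
    by (induction n) (simp_all add: assms)
  then have "(F ^^ n) T = (if n = 0 then T else 0)" for n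
    by (cases n) auto
  then have "coeff (op_subst f F T) w =
      (\<Sum>n\<le>length w. if n = 0 then of_Q (fps_nth f n) * coeff T w else 0)"
    unfolding op_subst_def coeff_Ncs by (intro sum.cong) auto
  then show "coeff (op_subst f F T) w = coeff (scale (of_Q (fps_nth f 0)) T) w"
    by simp
qed

lemma ad_subst_self: "ad_subst f S S = scale (of_Q (fps_nth f 0)) S"
  unfolding ad_subst_eq_op_subst by (rule op_subst_annihilated) (simp_all add: bracket_def)

lemma ad_subst_zero: "ad_subst f S 0 = 0"
  unfolding ad_subst_eq_op_subst by (subst op_subst_annihilated) (simp_all add: bracket_def)

lemma ad_subst_mult:
  "order_ge (Suc 0) S \<Longrightarrow> ad_subst (f * g) S T = ad_subst f S (ad_subst g S T)"
  by (simp add: ad_subst_eq_op_subst op_subst_mult raising_bracket)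

lemma linear_map_ad_subst: "linear_map (ad_subst f S)"
  unfolding ad_subst_eq_op_subst by (intro linear_map_op_subst linear_map_bracket)

definition sol_fps :: "rat fps" where
  "sol_fps = fps_const (1/2) * exp_quot"

definition sol :: "letter \<Rightarrow> letter \<Rightarrow> 'k::comm_rat_algebra ncs" where
  "sol a b = ad_subst sol_fps (var b) (BCH (var a) (var b) - var b)"

lemma ad_exp_BCH:
  "ad_subst (fps_exp 1) (var b) (BCH (var a) (var b) - var b) = BCH (var b) (var a) - var b"
  by (simp add: linear_map_diff[OF linear_map_ad_subst] ad_subst_self of_Q_1)
    (simp add: ad_exp order_ge_var BCH_conjugate[of "var b" "var a"])

lemma bracket_sol:
  "bracket (var b) (sol a b) = scale (of_Q (1/2)) (BCH (var b) (var a) - BCH (var a) (var b))"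
proof -
  have "fps_X * sol_fps = fps_const (1/2) * (fps_exp 1 - 1)"
    by (simp add: sol_fps_def algebra_simps flip: exp_quot_mult_X)
  moreover have "bracket (var b) (sol a b) =
      ad_subst (fps_X * sol_fps) (var b) (BCH (var a) (var b) - var b)"
    by (simp add: sol_def ad_subst_mult order_ge_var)
      (simp add: ad_subst_eq_op_subst op_subst_X raising_bracket order_ge_var)
  ultimately show ?thesis
    by (simp add: ad_subst_eq_op_subst op_subst_const_mult op_subst_diff op_subst_1)
      (simp add: ad_exp_BCH flip: ad_subst_eq_op_subst)
qed

text \<open>The product of \<open>\<eta>(u)\<close> and \<open>(e^u - 1)/(2u)\<close> is
  \<open>(e^u + 1)/4\<close>. At \<open>u = ad b\<close>, applied to \<open>BCH a b - b\<close>,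
  this is a quarter of \<open>BCH b a + BCH a b - 2 b\<close>.\<close>

lemma eta_sol:
  "ad_subst eta (var b) (sol a b :: 'k::comm_rat_algebra ncs) =
    scale (of_Q (1/2)) (odd_part (BCH (var a) (var b)) - var b)"
proof -
  have "eta * sol_fps * fps_X = fps_const (1/2) * (eta * (fps_exp 1 - 1))"
    by (simp add: sol_fps_def algebra_simps flip: exp_quot_mult_X)
  also have "\<dots> = fps_const (1/2) * (fps_const (1/2) * (fps_exp 1 + 1)) * fps_X"
    unfolding eta_mult by (simp only: ac_simps)
  finally have "eta * sol_fps = fps_const (1/2) * (fps_const (1/2) * (fps_exp 1 + 1))"
    using fps_X_neq_zero mult_right_cancel by blast
  moreover have "ad_subst eta (var b) (sol a b) =
      ad_subst (eta * sol_fps) (var b) (BCH (var a) (var b) - var b)"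
    by (simp add: sol_def ad_subst_mult order_ge_var)
  ultimately have eq: "ad_subst eta (var b) (sol a b) =
    scale (of_Q (1/2)) (scale (of_Q (1/2))
      (BCH (var b) (var a) - var b + (BCH (var a) (var b) - var b)))"
    by (simp only: ad_subst_eq_op_subst op_subst_const_mult op_subst_add op_subst_1)
      (simp only: ad_exp_BCH flip: ad_subst_eq_op_subst)
  have half: "scale (of_Q (1/2)) (P - Q + (R - Q)) =
      scale (of_Q (1/2)) (R + P) - (scale (of_Q (1/2)) Q + scale (of_Q (1/2)) Q)" for P Q R :: "'k ncs"
    by (simp add: scale_add scale_diff algebra_simps)
  show ?thesis
    unfolding eq odd_part_BCH half scale_half_double ..
qed

text \<open>The twist by the indicator of the words without \<open>a\<close> sets \<open>a\<close>
  to \<open>0\<close>. As \<open>BCH 0 b = b\<close>, it kills \<open>sol a b\<close>.\<close>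

lemma coeff_sol_pure:
  assumes "a \<noteq> b" "a \<notin> set w"
  shows "coeff (sol a b :: 'k::comm_rat_algebra ncs) w = 0"
proof -
  let ?c = "\<lambda>w. if a \<in> set w then 0 else 1 :: 'k"
  interpret multiplicative ?c
    by unfold_locales auto
  have a: "twist ?c (var a) = 0" and b: "twist ?c (var b) = var b"
    using assms(1) by (auto intro!: ncs_eqI simp: coeff_monom)
  have "nc_exp 0 = (1 :: 'k ncs)"
    unfolding nc_exp_def subst_eq_op_subst by (subst op_subst_annihilated) (simp_all add: of_Q_1)
  then have "BCH 0 (var b) = (var b :: 'k ncs)"
    by (simp add: BCH_def nc_log_exp order_ge_var)
  then have "twist ?c (BCH (var a) (var b)) = var b"
    by (simp add: twist_BCH order_ge_var a b)
  then have "twist ?c (sol a b) = 0"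
    by (simp add: sol_def twist_ad_subst order_ge_var b linear_map_diff[OF linear_map_twist]
        ad_subst_zero)
  then have "coeff (twist ?c (sol a b)) w = 0" by simp
  then show ?thesis using assms(2) by simp
qed

section \<open>The adjoint action of associative series\<close>

definition ad_word :: "letter list \<Rightarrow> 'k::comm_ring_1 ncs \<Rightarrow> 'k ncs" where
  "ad_word u T = foldr (\<lambda>x. bracket (var x)) u T"

lemma ad_word_simps [simp]:
  "ad_word [] T = T" "ad_word (x # u) T = bracket (var x) (ad_word u T)"
  by (simp_all add: ad_word_def)

lemma ad_word_append: "ad_word (u @ v) T = ad_word u (ad_word v T)"
  by (simp add: ad_word_def)

text \<open>\<open>adh\<close> is the homomorphism from the associative series to the endomorphisms
  that sends each letter \<open>x\<close> to \<open>ad x\<close>; for other Lie series than the letters it is not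
  evident that \<open>adh P\<close> is \<open>bracket P\<close>.\<close>

definition adh :: "'k::comm_ring_1 ncs \<Rightarrow> 'k ncs \<Rightarrow> 'k ncs" where
  "adh P T = Ncs (\<lambda>w. \<Sum>u | length u \<le> length w. coeff P u * coeff (ad_word u T) w)"

lemma finite_words_le: "finite {u :: letter list. length u \<le> n}"
proof -
  have "{u :: letter list. length u \<le> n} = (\<Union>m\<le>n. {u. length u = m})"
    by auto
  then show ?thesis by (simp add: finite_words)
qed

lemma linear_map_ad_word: "linear_map (ad_word u)"
proof (induction u)
  case Nil
  then show ?case by (simp add: linear_map_def)
next
  case (Cons x u)
  then show ?case
    by (simp add: linear_map_def linear_map_add[OF linear_map_bracket]
        linear_map_scale[OF linear_map_bracket])
qed

lemma order_ge_ad_word: "order_ge n T \<Longrightarrow> order_ge (length u + n) (ad_word u T)"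
proof (induction u)
  case (Cons x u)
  then show ?case
    using order_ge_bracket[OF order_ge_var[of x], of "length u + n" "ad_word u T"] by simp
qed simp

lemma coeff_ad_word_short: "length w < length u \<Longrightarrow> coeff (ad_word u T) w = 0"
  using order_ge_ad_word[of 0 T u] by (simp add: order_ge_def)

lemma coeff_adh:
  assumes "length w \<le> N"
  shows "coeff (adh P T) w = (\<Sum>u | length u \<le> N. coeff P u * coeff (ad_word u T) w)"
  unfolding adh_def coeff_Ncs
  by (rule sum.mono_neutral_left) (use assms in \<open>auto simp: finite_words_le coeff_ad_word_short\<close>)

lemma linear_map_adh_left: "linear_map (\<lambda>P. adh P T)"
  unfolding linear_map_def
  by (auto intro!: ncs_eqI simp: adh_def algebra_simps sum.distrib sum_distrib_left)

lemma linear_map_adh: "linear_map (adh P)"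
  unfolding linear_map_def
  by (auto intro!: ncs_eqI simp: adh_def linear_map_add[OF linear_map_ad_word]
      linear_map_scale[OF linear_map_ad_word] algebra_simps sum.distrib sum_distrib_left)

lemma order_ge_adh:
  assumes P: "order_ge m P" and T: "order_ge n T"
  shows "order_ge (m + n) (adh P T)"
  unfolding order_ge_def
proof (intro allI impI)
  fix w :: "letter list"
  assume w: "length w < m + n"
  have "coeff P u * coeff (ad_word u T) w = 0" for u
  proof (cases "length u < m")
    case True
    then show ?thesis using P by (simp add: order_ge_def)
  next
    case False
    then show ?thesis using order_ge_ad_word[OF T, of u] w by (simp add: order_ge_def)
  qed
  then show "coeff (adh P T) w = 0"
    by (simp add: adh_def)
qed

text \<open>Concatenation of words becomes composition under \<open>ad_word\<close>. Words with a
  cut correspond to pairs \<open>(u, v)\<close>, and pairs of total length above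
  \<open>length w\<close> contribute \<open>0\<close>.\<close>

lemma adh_mult: "adh (P * Q) T = adh P (adh Q T)"
proof (rule ncs_eqI)
  fix w :: "letter list"
  let ?W = "{u :: letter list. length u \<le> length w}"
  let ?t = "\<lambda>u v. coeff P u * coeff Q v * coeff (ad_word (u @ v) T) w"
  \<comment> \<open>To move \<open>ad_word u\<close> into an infinite sum, the sum is cut off: the
    rest \<open>?D\<close> lies beyond the degree of \<open>w\<close>, and brackets with letters do
    not lower the order.\<close>
  have approx: "coeff (ad_word u (adh Q T)) w = (\<Sum>v\<in>?W. coeff Q v * coeff (ad_word (u @ v) T) w)" for u
  proof -
    let ?D = "adh Q T - (\<Sum>v\<in>?W. scale (coeff Q v) (ad_word v T))"
    have "order_ge (Suc (length w)) ?D"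
      by (simp add: order_ge_def coeff_sum coeff_adh[of _ "length w"])
    from order_ge_ad_word[OF this, of u] have "coeff (ad_word u ?D) w = 0"
      by (simp add: order_ge_def)
    then show ?thesis
      by (simp add: linear_map_diff[OF linear_map_ad_word] linear_map_sum[OF linear_map_ad_word]
          linear_map_scale[OF linear_map_ad_word] coeff_sum ad_word_append)
  qed
  have "coeff (adh (P * Q) T) w = (\<Sum>x\<in>?W. \<Sum>i\<le>length x. ?t (take i x) (drop i x))"
    by (simp add: adh_def coeff_mult sum_distrib_right flip: ad_word_append)
  also have "\<dots> = (\<Sum>(x, i)\<in>(SIGMA x:?W. {..length x}). ?t (take i x) (drop i x))"
    by (rule sum.Sigma) (simp_all add: finite_words_le)
  also have "\<dots> = (\<Sum>(u, v)\<in>{(u, v). length u + length v \<le> length w}. ?t u v)"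
    by (rule sum.reindex_bij_witness[of _ "\<lambda>(u, v). (u @ v, length u)" "\<lambda>(x, i). (take i x, drop i x)"])
      (auto simp: min_def)
  also have "\<dots> = (\<Sum>(u, v)\<in>?W \<times> ?W. ?t u v)"
  proof (rule sum.mono_neutral_left)
    have "?t u v = 0" if "\<not> length u + length v \<le> length w" for u v
      using that by (simp add: coeff_ad_word_short)
    then have "(case p of (u, v) \<Rightarrow> ?t u v) = 0"
      if "p \<notin> {(u, v). length u + length v \<le> length w}" for p
      using that by (simp only: case_prod_beta mem_Collect_eq)
    then show "\<forall>p\<in>?W \<times> ?W - {(u, v). length u + length v \<le> length w}.
        (case p of (u, v) \<Rightarrow> ?t u v) = 0"
      by blast
  qed (auto simp: finite_words_le)
  also have "\<dots> = (\<Sum>u\<in>?W. \<Sum>v\<in>?W. ?t u v)"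
    by (rule sum.cartesian_product[symmetric])
  also have "\<dots> = coeff (adh P (adh Q T)) w"
    by (simp add: adh_def[of P] approx sum_distrib_left mult.assoc)
  finally show "coeff (adh (P * Q) T) w = coeff (adh P (adh Q T)) w" .
qed

lemma adh_monom: "adh (monom u) T = ad_word u T"
proof (rule ncs_eqI)
  fix w
  have "coeff (adh (monom u) T) w =
      (\<Sum>v | length v \<le> max (length u) (length w). if v = u then coeff (ad_word u T) w else 0)"
    unfolding coeff_adh[OF max.cobounded2[of "length w" "length u"]]
    by (intro sum.cong) (auto simp: coeff_monom)
  then show "coeff (adh (monom u) T) w = coeff (ad_word u T) w"
    by (simp add: finite_words_le)
qed

lemma adh_var: "adh (var v) = bracket (var v)"
  by (rule ext) (simp add: adh_monom)

lemma adh_1: "adh 1 T = T"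
proof -
  have "1 = (monom [] :: 'a ncs)"
    by (rule ncs_eqI) (simp add: coeff_1 coeff_monom)
  with adh_monom[of "[]" T] show ?thesis by simp
qed

text \<open>Naturality for \<open>P \<mapsto> adh P T\<close>, which by \<open>adh_mult\<close>
  carries left multiplication by \<open>S\<close> to \<open>adh S\<close>.\<close>

lemma adh_subst:
  assumes "order_ge (Suc 0) S"
  shows "adh (subst f S) T = op_subst f (adh S) T"
proof -
  have "raising (adh S)"
    unfolding raising_def using order_ge_adh[OF assms] by (simp add: linear_map_adh)
  moreover have "continuous_map (\<lambda>P. adh P T)"
    using order_ge_adh[OF _ order_ge_0[of T]]
    by (intro continuous_mapI[where c = 0]) (simp_all add: linear_map_adh_left)
  ultimately have "adh (op_subst f ((*) S) 1) T = op_subst f (adh S) (adh 1 T)"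
    by (intro op_subst_natural[where G = "\<lambda>P. adh P T"] raising_mult_left assms adh_mult)
  then show ?thesis
    by (simp add: subst_eq_op_subst adh_1)
qed

lemma adh_nc_exp_var: "adh (nc_exp (var v)) T = nc_exp (var v) * T * nc_exp (- var v)"
  unfolding nc_exp_def[of "var v"]
  by (simp add: adh_subst order_ge_var adh_var flip: ad_subst_eq_op_subst)
    (simp add: ad_exp order_ge_var nc_exp_def)

section \<open>A Dynkin formula for the Baker-Campbell-Hausdorff series\<close>

text \<open>Up to its constant term, \<open>P\<close> is the sum of the
  \<open>rquot v P * var v\<close>; these are Fox derivatives with the letter split off on the
  right.\<close>

definition rquot :: "letter \<Rightarrow> 'k::comm_ring_1 ncs \<Rightarrow> 'k ncs" where
  "rquot v P = Ncs (\<lambda>u. coeff P (u @ [v]))"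

lemma coeff_rquot [simp]: "coeff (rquot v P) u = coeff P (u @ [v])"
  by (simp add: rquot_def)

lemma rquot_mult: "rquot v (P * Q) = P * rquot v Q + scale (coeff Q []) (rquot v P)"
  by (rule ncs_eqI, simp add: coeff_mult_snoc, simp add: coeff_mult mult.commute)

lemma rquot_var: "rquot v (var x) = (if x = v then 1 else 0)"
  by (rule ncs_eqI) (simp add: coeff_monom coeff_1)

lemma rquot_1: "rquot v 1 = 0"
  by (rule ncs_eqI) (simp add: coeff_1)

lemma linear_map_rquot: "linear_map (rquot v)"
  unfolding linear_map_def by (auto intro!: ncs_eqI)

lemma continuous_rquot: "continuous_map (rquot v)"
  by (rule continuous_mapI[where c = 1]) (auto simp: linear_map_rquot order_ge_def)

text \<open>In \<open>bracket (var b) P\<close> the words of \<open>P * var b\<close> end with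
  \<open>b\<close>, so \<open>rquot a\<close> turns the bracket with \<open>b\<close> into left
  multiplication by \<open>b\<close>.\<close>

lemma rquot_ad_subst:
  assumes "a \<noteq> b"
  shows "rquot a (ad_subst f (var b) T) = subst f (var b) * rquot a T"
proof -
  have "rquot a (bracket (var b) P) = var b * rquot a P" for P :: "'a ncs"
    using assms by (simp add: bracket_def linear_map_diff[OF linear_map_rquot] rquot_mult rquot_var
        coeff_monom)
  then show ?thesis
    unfolding ad_subst_eq_op_subst subst_mult_eq_op_subst[OF order_ge_var]
    by (intro op_subst_natural raising_bracket raising_mult_left order_ge_var continuous_rquot)
qed

lemma nc_exp_eq_quot:
  assumes "order_ge (Suc 0) S"
  shows "nc_exp S = subst exp_quot S * S + 1"
proof -
  have "fps_exp 1 = exp_quot * fps_X + 1"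
    by (simp add: exp_quot_mult_X)
  then show ?thesis
    unfolding nc_exp_def using assms by (simp add: subst_add subst_mult subst_X subst_1)
qed

lemma rquot_nc_exp_var:
  "rquot v (nc_exp (var x)) = (if x = v then subst exp_quot (var v) else 0)"
  by (simp add: nc_exp_eq_quot order_ge_var linear_map_add[OF linear_map_rquot] rquot_mult
      rquot_var rquot_1 coeff_monom)

text \<open>With \<open>M = e^a e^b - 1\<close>, the series \<open>log (1 + M)\<close> is
  \<open>log (1 + M)/M\<close> times \<open>M\<close>. As \<open>M\<close> has no constant term,
  stripping a final \<open>a\<close> affects only this last factor, where \<open>e^b\<close>
  contributes just its constant term.\<close>

lemma rquot_BCH:
  assumes "a \<noteq> b"
  shows "rquot a (BCH (var a) (var b)) =
    subst ln_quot (nc_exp (var a) * nc_exp (var b) - 1) * subst exp_quot (var a)"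
proof -
  let ?M = "nc_exp (var a) * nc_exp (var b) - 1 :: 'a ncs"
  have M: "order_ge (Suc 0) ?M"
    by (simp add: order_ge_coeff_Nil coeff_mult_Nil coeff_nc_exp_Nil coeff_1)
  have "BCH (var a) (var b) = subst ln_quot ?M * ?M"
    unfolding BCH_def nc_log_def
    by (simp add: M subst_mult subst_X flip: ln_quot_mult_X)
  moreover have "rquot a ?M = subst exp_quot (var a)"
    using assms
    by (simp add: linear_map_diff[OF linear_map_rquot] rquot_mult rquot_nc_exp_var rquot_1
        coeff_nc_exp_Nil)
  moreover have "coeff ?M [] = 0"
    using M by (simp add: order_ge_coeff_Nil)
  ultimately show ?thesis
    by (simp add: rquot_mult)
qed

lemma deg_nc_exp_var:
  "deg v (nc_exp (var x)) = (if x = v then var v * nc_exp (var v) else 0)"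
  by (simp add: deg_nc_exp order_ge_var deg_var ad_subst_self ad_subst_zero exp_quot_def of_Q_1)

lemma nc_exp_mult_cancel:
  assumes "order_ge (Suc 0) S"
  shows "nc_exp S * (nc_exp (- S) * P) = P"
  using nc_exp_mult_uminus[OF assms] by (simp flip: mult.assoc)

text \<open>Both sides are the logarithmic derivative \<open>D(e^L) e^(-L)\<close> for
  \<open>D = deg v\<close> and \<open>L = BCH a b\<close>: once by \<open>deg_nc_exp\<close>, once
  by the product rule for \<open>e^a e^b\<close>.\<close>

lemma ad_exp_quot_deg_BCH:
  "ad_subst exp_quot (BCH (var a) (var b)) (deg v (BCH (var a) (var b))) =
    (if a = v then var v else 0) +
    (if b = v then nc_exp (var a) * var v * nc_exp (- var a) else 0 :: 'k::comm_rat_algebra ncs)"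
proof -
  let ?L = "BCH (var a) (var b) :: 'k ncs"
  let ?G = "nc_exp (var a) * nc_exp (var b) :: 'k ncs"
  let ?G' = "nc_exp (- var b) * nc_exp (- var a) :: 'k ncs"
  have "ad_subst exp_quot ?L (deg v ?L) * ?G = deg v ?G"
    using deg_nc_exp[OF order_ge_BCH[of "var a" "var b :: 'k ncs"], of v] by (simp add: nc_exp_BCH)
  then have "ad_subst exp_quot ?L (deg v ?L) * ?G * ?G' = deg v ?G * ?G'"
    by simp
  then show ?thesis
    by (cases "a = v"; cases "b = v")
      (simp_all add: deg_mult deg_nc_exp_var distrib_right mult.assoc nc_exp_mult_uminus
        nc_exp_mult_cancel order_ge_var)
qed

text \<open>By \<open>rquot_BCH\<close> the left hand side is \<open>log (1 + v)/v\<close> at the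
  operator \<open>v = e^(ad L) - 1\<close>, applied to \<open>a\<close>. The logarithmic derivative
  writes \<open>a\<close> as \<open>(e^u - 1)/u\<close> at \<open>u = ad L\<close>, applied to
  \<open>deg a L\<close>, and these two series are inverse to each other.\<close>

lemma Dynkin_BCH:
  assumes "a \<noteq> b"
  shows "adh (rquot a (BCH (var a) (var b))) (var a) = deg a (BCH (var a) (var b))"
proof -
  let ?L = "BCH (var a) (var b) :: 'a ncs"
  let ?M = "nc_exp (var a) * nc_exp (var b) - 1 :: 'a ncs"
  have M: "order_ge (Suc 0) ?M"
    by (simp add: order_ge_coeff_Nil coeff_mult_Nil coeff_nc_exp_Nil coeff_1)
  \<comment> \<open>On \<open>e^a e^b\<close> the map \<open>adh\<close> gives the successive
    conjugations, hence conjugation by \<open>e^L\<close>, which is \<open>e^(ad L)\<close>. This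
    bypasses a comparison of \<open>adh ?L\<close> with \<open>bracket ?L\<close>.\<close>
  have E: "ad_subst (fps_exp 1 - 1) ?L = adh ?M"
  proof
    fix T :: "'a ncs"
    have "ad_subst (fps_exp 1 - 1) ?L T = nc_exp ?L * T * nc_exp (- ?L) - T"
      by (simp add: ad_subst_eq_op_subst op_subst_diff op_subst_1)
        (simp add: ad_exp order_ge_BCH flip: ad_subst_eq_op_subst)
    also have "\<dots> = adh ?M T"
      by (simp add: linear_map_diff[OF linear_map_adh_left] adh_mult adh_nc_exp_var adh_1
          nc_exp_BCH nc_exp_uminus_BCH order_ge_var mult.assoc)
    finally show "ad_subst (fps_exp 1 - 1) ?L T = adh ?M T" .
  qed
  have "adh (rquot a ?L) (var a) = op_subst ln_quot (adh ?M) (ad_subst exp_quot (var a) (var a))"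
    by (simp add: rquot_BCH assms adh_mult adh_subst M order_ge_var adh_var flip: ad_subst_eq_op_subst)
  \<comment> \<open>The bracket of \<open>a\<close> with itself is \<open>0\<close>, so only the
    constant term 1 of \<open>exp_quot\<close> acts.\<close>
  also have "\<dots> = op_subst ln_quot (adh ?M) (var a)"
    by (simp add: ad_subst_self exp_quot_def of_Q_1)
  also have "\<dots> = ad_subst (ln_quot oo (fps_exp 1 - 1)) ?L (var a)"
    unfolding E[symmetric] ad_subst_eq_op_subst
    by (simp add: op_subst_compose raising_bracket order_ge_BCH)
  also have "\<dots> = ad_subst (ln_quot oo (fps_exp 1 - 1)) ?L (ad_subst exp_quot ?L (deg a ?L))"
    using assms by (simp add: ad_exp_quot_deg_BCH)
  also have "\<dots> = deg a ?L"
    by (simp add: order_ge_BCH ln_quot_compose_exp_mult flip: ad_subst_mult)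
      (simp add: ad_subst_eq_op_subst op_subst_1)
  finally show ?thesis .
qed

text \<open>Since \<open>b\<close> is a letter other than \<open>a\<close>, both sides for
  \<open>sol a b\<close> arise from those for \<open>BCH a b\<close> by applying
  \<open>sol_fps\<close> at \<open>ad b\<close>.\<close>

lemma Dynkin_sol:
  assumes "a \<noteq> b"
  shows "adh (rquot a (sol a b)) (var a) = deg a (sol a b :: 'k::comm_rat_algebra ncs)"
proof -
  have "rquot a (sol a b :: 'k ncs) = subst sol_fps (var b) * rquot a (BCH (var a) (var b))"
    using assms by (simp add: sol_def rquot_ad_subst linear_map_diff[OF linear_map_rquot] rquot_var)
  then have "adh (rquot a (sol a b)) (var a :: 'k ncs) = ad_subst sol_fps (var b) (deg a (BCH (var a) (var b)))"
    using assms
    by (simp add: adh_mult Dynkin_BCH) (simp add: adh_subst order_ge_var adh_var ad_subst_eq_op_subst)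
  also have "\<dots> = deg a (sol a b)"
    using assms
    by (simp add: sol_def deg_ad_subst order_ge_var deg_var linear_map_diff[OF linear_map_deg])
  finally show ?thesis .
qed

section \<open>Evaluation of \<open>deltaL\<close>\<close>

lemma nested_bracket_snoc: "nested_bracket (u @ [v]) = ad_word u (var v)"
proof (induction u)
  case (Cons x u)
  then show ?case by (cases u) simp_all
qed simp

lemma deg_ad_word_var: "deg v (ad_word u (var v)) = scale (of_nat (Suc (count_list u v))) (ad_word u (var v))"
proof (induction u)
  case Nil
  then show ?case by (simp add: deg_var)
next
  case (Cons x u)
  then show ?case
    by (auto simp: deg_bracket deg_var linear_map_scale[OF linear_map_bracket]
        linear_map_add[OF linear_map_bracket] scale_plus bracket_def[of 0] ncs_eqI algebra_simps)
qed

text \<open>By \<open>deg_ad_word_var\<close> the coefficient has the same product with two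
  different integers, so a nonzero multiple of it vanishes.\<close>

lemma coeff_ad_word_var_eq_0:
  assumes "count_list w v \<noteq> Suc (count_list u v)"
  shows "coeff (ad_word u (var v) :: 'k::comm_rat_algebra ncs) w = 0"
proof -
  let ?c = "coeff (ad_word u (var v) :: 'k ncs) w"
  let ?m = "count_list w v" and ?n = "Suc (count_list u v)"
  have eq: "of_nat ?m * ?c = of_nat ?n * ?c"
    using arg_cong[OF deg_ad_word_var[of v u, where 'a = 'k], of "\<lambda>P. coeff P w"] by simp
  show ?thesis
  proof (rule of_nat_mult_cancel)
    \<comment> \<open>Maximum minus minimum covers both signs of the difference within the natural
      numbers.\<close>
    show "max ?m ?n - min ?m ?n \<noteq> 0"
      using assms by (simp only: max_def min_def split: if_split) linarith
    show "of_nat (max ?m ?n - min ?m ?n) * ?c = of_nat (max ?m ?n - min ?m ?n) * 0"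
      using eq by (cases "?m \<le> ?n") (simp_all add: max_def min_def of_nat_diff left_diff_distrib)
  qed
qed

lemma sum_weight: "(\<Sum>x\<leftarrow>u. weight v x) = of_nat (count_list u v)"
  by (induction u) (simp_all add: weight_def)

lemma coeff_bracket_var_snoc:
  assumes "a \<noteq> b"
  shows "coeff (bracket (var b) P) (z # t @ [a]) = (if z = b then coeff P (t @ [a]) else 0)"
proof -
  have "rquot a (P * var b) = 0"
    using assms by (simp add: rquot_mult rquot_var coeff_monom)
  then have "coeff (rquot a (P * var b)) (z # t) = 0" by simp
  then show ?thesis
    by (simp add: bracket_def coeff_var_mult)
qed

text \<open>Only words \<open>b t a\<close> survive: the weight forces the last letter, and then the
  bracket forces the first. The nested bracket of \<open>t a\<close> is homogeneous in
  \<open>a\<close>, so the denominator is the number of letters \<open>a\<close> in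
  \<open>q\<close>, and the Dynkin formula cancels it.\<close>

lemma deltaL_bracket:
  fixes P :: "'k::comm_rat_algebra ncs"
  assumes ab: "a \<noteq> b" and Dynkin: "adh (rquot a P) (var a) = deg a P"
    and pure: "\<And>w. a \<notin> set w \<Longrightarrow> coeff P w = 0"
  shows "deltaL a (bracket (var b) P) [z] q = (if z = b then coeff P q else 0)"
proof -
  let ?Q = "bracket (var b) P"
  let ?U = "{u :: letter list. 2 \<le> length u \<and> length u = Suc (length q)}"
  let ?T = "{t :: letter list. Suc (length t) = length q}"
  let ?f = "\<lambda>u. of_Q (weight a (last u) / (\<Sum>x\<leftarrow>u. weight a x)) * coeff ?Q u *
     tensor (var (hd u)) (nested_bracket (tl u)) [z] q"
  let ?m = "count_list q a"
  have "deltaL a ?Q [z] q = sum ?f ?U"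
    by (simp add: deltaL_def)
  also have "\<dots> = sum ?f ((\<lambda>t. z # t @ [a]) ` ?T)"
  proof (rule sum.mono_neutral_right)
    show "finite ?U"
      by (rule finite_subset[OF _ finite_words[of "Suc (length q)"]]) auto
    show "\<forall>u \<in> ?U - (\<lambda>t. z # t @ [a]) ` ?T. ?f u = 0"
    proof
      fix u assume u: "u \<in> ?U - (\<lambda>t. z # t @ [a]) ` ?T"
      then obtain x y t where xy: "u = x # t @ [y]" "Suc (length t) = length q"
        by (cases u; cases "tl u" rule: rev_cases) auto
      with u have "x \<noteq> z \<or> y \<noteq> a" by auto
      then show "?f u = 0"
        by (auto simp: xy tensor_def coeff_monom weight_def of_Q_0)
    qed
  qed auto
  also have "\<dots> = (\<Sum>t\<in>?T. ?f (z # t @ [a]))"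
    by (subst sum.reindex) (auto simp: inj_on_def)
  also have "\<dots> = (\<Sum>t\<in>?T. if z = b then of_Q (1 / of_nat ?m) *
      (coeff (rquot a P) t * coeff (ad_word t (var a)) q) else 0)"
  proof (rule sum.cong[OF refl])
    fix t
    show "?f (z # t @ [a]) = (if z = b then of_Q (1 / of_nat ?m) *
      (coeff (rquot a P) t * coeff (ad_word t (var a)) q) else 0)"
    \<comment> \<open>If the numbers of letters \<open>a\<close> differ, the nested bracket has
      coefficient \<open>0\<close> at \<open>q\<close>; so the denominator can be taken as
      \<open>?m\<close> for every \<open>t\<close>.\<close>
    proof (cases "z = b \<and> ?m = Suc (count_list t a)")
      case True
      then have z: "z = b" and m: "(\<Sum>x\<leftarrow>t @ [a]. weight a x) = of_nat ?m"
        by (simp_all add: sum_weight weight_def[of a a])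
      have w: "weight a b = 0"
        using ab by (simp add: weight_def)
      have w': "weight a a = 1"
        by (simp add: weight_def)
      show ?thesis
        using m by (simp add: tensor_def coeff_monom coeff_bracket_var_snoc ab nested_bracket_snoc z w w' mult.assoc)
    next
      case False
      then show ?thesis
        by (auto simp: tensor_def coeff_bracket_var_snoc[OF ab] nested_bracket_snoc coeff_ad_word_var_eq_0)
    qed
  qed
  also have "\<dots> = (if z = b then of_Q (1 / of_nat ?m) *
      (\<Sum>t\<in>?T. coeff (rquot a P) t * coeff (ad_word t (var a)) q) else 0)"
    by (simp add: sum_distrib_left)
  also have "(\<Sum>t\<in>?T. coeff (rquot a P) t * coeff (ad_word t (var a)) q) =
      coeff (adh (rquot a P) (var a)) q"
    unfolding adh_def coeff_Ncs
  proof (rule sum.mono_neutral_left)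
    have "coeff (ad_word t (var a)) q = (0 :: 'k)" if "t \<notin> ?T" for t
      using that coeff_nested_bracket[of q "t @ [a]", where 'k = 'k] by (simp add: nested_bracket_snoc)
    then show "\<forall>t\<in>{t. length t \<le> length q} - ?T. coeff (rquot a P) t * coeff (ad_word t (var a)) q = 0"
      by simp
  qed (auto simp: finite_words_le)
  also have "of_Q (1 / of_nat ?m) * coeff (adh (rquot a P) (var a)) q = coeff P q"
  \<comment> \<open>In this case \<open>1 / 0 = 0\<close> makes the left hand side vanish, and
    \<open>pure\<close> the right hand side.\<close>
  proof (cases "?m = 0")
    case True
    then show ?thesis by (simp add: Dynkin pure count_list_0_iff)
  next
    case False
    then show ?thesis
      using of_Q_inverse_mult_of_nat[OF False, where 'k = 'k] by (simp add: Dynkin flip: mult.assoc)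
  qed
  finally show ?thesis .
qed

section \<open>The trace\<close>

text \<open>Rotation is periodic with period \<open>length w\<close>, so a shift by one drops a term
  and adds an equal one.\<close>

lemma sum_rotate_shift: "(\<Sum>i<length w. f (rotate (i + k) w)) = (\<Sum>i<length w. f (rotate i w))"
  for f :: "'a list \<Rightarrow> 'b::comm_ring_1"
proof (induction k)
  case (Suc k)
  let ?g = "\<lambda>i. f (rotate (i + k) w)"
  have "(\<Sum>i<length w. ?g (Suc i)) + ?g 0 = (\<Sum>i<length w. ?g i) + ?g (length w)"
    using sum.lessThan_Suc[of ?g "length w"] sum.lessThan_Suc_shift[of ?g "length w"]
    by (simp only: add.commute)
  moreover have "rotate (length w + k) w = rotate k w"
    using rotate_conv_mod[of "length w + k" w] rotate_conv_mod[of k w] by (simp only: mod_add_self1)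
  then have "?g (length w) = ?g 0"
    by (simp only: add_0)
  ultimately show ?case
    using Suc by simp
qed simp

lemma coeff_Tr_Nil: "coeff (Tr P) [] = coeff P []"
  by (simp add: Tr_def cyc_sym_def coeff_1)

text \<open>Inverting the rotations that take \<open>u\<close> to \<open>w\<close> turns the sum
  over \<open>u\<close> into the average of \<open>P\<close> over the rotations of
  \<open>w\<close>.\<close>

lemma coeff_Tr:
  assumes "w \<noteq> []"
  shows "coeff (Tr P) w = of_Q (1 / of_nat (length w)) * (\<Sum>i<length w. coeff P (rotate i w))"
proof -
  let ?n = "length w"
  let ?c = "of_Q (1 / of_nat ?n)"
  have rot: "w = rotate i u \<longleftrightarrow> u = rotate (?n - i) w" if "i < ?n" "length u = ?n" for i u
  proof -
    have "rotate (?n - i) (rotate i u) = u" "rotate i (rotate (?n - i) w) = w"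
      using that by (simp_all add: rotate_rotate rotate_id)
    then show ?thesis by metis
  qed
  have "coeff (Tr P) w = (\<Sum>u | length u = ?n. \<Sum>i<?n. if w = rotate i u then ?c * coeff P u else 0)"
    unfolding Tr_def coeff_Ncs
  proof (rule sum.cong[OF refl])
    fix u :: "letter list" assume "u \<in> {u. length u = ?n}"
    then have "length u = ?n" "u \<noteq> []"
      using assms by auto
    then have cyc: "coeff (cyc_sym u) w = ?c * (\<Sum>i<?n. if w = rotate i u then 1 else 0)"
      by (simp add: cyc_sym_def coeff_sum coeff_monom)
    show "coeff P u * coeff (cyc_sym u) w = (\<Sum>i<?n. if w = rotate i u then ?c * coeff P u else 0)"
      unfolding cyc sum_distrib_left by (rule sum.cong[OF refl]) (simp add: mult.commute)
  qed
  also have "\<dots> = (\<Sum>i<?n. \<Sum>u | length u = ?n. if w = rotate i u then ?c * coeff P u else 0)"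
    by (rule sum.swap)
  also have "\<dots> = (\<Sum>i<?n. \<Sum>u | length u = ?n. if u = rotate (?n - i) w then ?c * coeff P (rotate (?n - i) w) else 0)"
    by (intro sum.cong refl) (auto simp: rot)
  also have "\<dots> = (\<Sum>i<?n. ?c * coeff P (rotate (?n - i) w))"
    by (intro sum.cong refl) (simp add: finite_words)
  \<comment> \<open>The exponents \<open>?n - i\<close> run from \<open>?n\<close> down to
    \<open>1\<close>; in reverse order they are \<open>i + 1\<close>.\<close>
  also have "\<dots> = (\<Sum>i<?n. ?c * coeff P (rotate (i + 1) w))"
    by (subst sum.nat_diff_reindex[symmetric]) (auto intro!: sum.cong simp: Suc_diff_Suc)
  also have "\<dots> = (\<Sum>i<?n. ?c * coeff P (rotate i w))"
    by (rule sum_rotate_shift)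
  finally show ?thesis
    by (simp add: sum_distrib_left)
qed

lemma linear_map_Tr: "linear_map Tr"
  unfolding linear_map_def
  by (auto intro!: ncs_eqI simp: Tr_def algebra_simps sum.distrib sum_distrib_left)

text \<open>Rotating a word by \<open>j\<close> exchanges the two pieces of its cut at position
  \<open>j\<close>, hence the two factors.\<close>

lemma Tr_mult_commute: "Tr (P * Q) = Tr (Q * P)"
proof (rule ncs_eqI)
  fix w
  show "coeff (Tr (P * Q)) w = coeff (Tr (Q * P)) w"
  proof (cases "w = []")
    case True
    then show ?thesis by (simp add: coeff_Tr_Nil coeff_mult_Nil mult.commute)
  next
    case False
    let ?n = "length w"
    let ?f = "\<lambda>j u. coeff P (take j u) * coeff Q (drop j u)"
    let ?g = "\<lambda>j u. coeff Q (take (?n - j) u) * coeff P (drop (?n - j) u)"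
    have rot: "?g j (rotate j u) = ?f j u" if "j \<le> ?n" "length u = ?n" for j u
    \<comment> \<open>This case is separate because \<open>rotate_drop_take\<close> reduces
      \<open>j\<close> modulo the length.\<close>
    proof (cases "j = ?n")
      case True
      then show ?thesis using that by (simp add: rotate_rotate mult.commute)
    next
      case False
      then have "rotate j u = drop j u @ take j u"
        using that by (simp add: rotate_drop_take)
      then show ?thesis using that by (simp add: mult.commute)
    qed
    have "(\<Sum>i<?n. coeff (P * Q) (rotate i w)) = (\<Sum>j\<le>?n. \<Sum>i<?n. ?f j (rotate i w))"
      unfolding coeff_mult by (simp add: sum.swap[of _ "{..?n}"])
    also have "\<dots> = (\<Sum>j\<le>?n. \<Sum>i<?n. ?g j (rotate (i + j) w))"
      by (intro sum.cong refl) (simp add: rot add.commute flip: rotate_rotate)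
    also have "\<dots> = (\<Sum>j\<le>?n. \<Sum>i<?n. ?g j (rotate i w))"
      by (intro sum.cong refl sum_rotate_shift)
    also have "\<dots> = (\<Sum>i<?n. \<Sum>j\<le>?n. ?g j (rotate i w))"
      by (rule sum.swap)
    also have "\<dots> = (\<Sum>i<?n. coeff (Q * P) (rotate i w))"
    proof (rule sum.cong[OF refl])
      fix i
      show "(\<Sum>j\<le>?n. ?g j (rotate i w)) = coeff (Q * P) (rotate i w)"
        unfolding coeff_mult by (rule sum.reindex_bij_witness[of _ "\<lambda>j. ?n - j" "\<lambda>j. ?n - j"]) auto
    qed
    finally show ?thesis
      using False by (simp add: coeff_Tr)
  qed
qed

lemma Tr_bracket: "Tr (bracket P Q) = 0"
  by (simp add: bracket_def linear_map_diff[OF linear_map_Tr] Tr_mult_commute[of P Q])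

lemma Tr_conjugate: "Q' * Q = 1 \<Longrightarrow> Tr (Q * P * Q') = Tr P"
  using Tr_mult_commute[of "Q * P" Q'] by (simp flip: mult.assoc)

text \<open>Apart from its constant term, \<open>f\<close> is a multiple of \<open>u\<close>, and
  this part yields a bracket, which has trace \<open>0\<close>.\<close>

lemma Tr_ad_subst:
  assumes "order_ge (Suc 0) S"
  shows "Tr (ad_subst f S T) = scale (of_Q (fps_nth f 0)) (Tr T)"
proof -
  have "f = fps_X * fps_shift 1 f + fps_const (fps_nth f 0) * 1"
    by (rule fps_ext) simp
  then have "ad_subst f S T = ad_subst (fps_X * fps_shift 1 f + fps_const (fps_nth f 0) * 1) S T"
    by simp
  also have "\<dots> = bracket S (ad_subst (fps_shift 1 f) S T) + scale (of_Q (fps_nth f 0)) T"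
    using raising_bracket[OF assms]
    by (simp only: ad_subst_eq_op_subst op_subst_add op_subst_const_mult op_subst_1 op_subst_mult
        op_subst_X)
  finally show ?thesis
    by (simp add: linear_map_add[OF linear_map_Tr] linear_map_scale[OF linear_map_Tr] Tr_bracket)
qed

lemma count_list_rotate: "count_list (rotate i w) v = count_list w v"
  by (metis append_take_drop_id count_list_append add.commute rotate_drop_take)

lemma deg_Tr: "deg v (Tr P) = Tr (deg v P)"
proof (rule ncs_eqI)
  fix w
  show "coeff (deg v (Tr P)) w = coeff (Tr (deg v P)) w"
    by (cases "w = []")
      (simp_all add: coeff_Tr_Nil coeff_Tr count_list_rotate sum_distrib_left mult.left_commute)
qed

text \<open>The trace does not see \<open>(e^u - 1)/u\<close> at \<open>u = ad L\<close>, nor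
  conjugations, so the logarithmic derivative gives \<open>deg v L\<close> and
  \<open>deg v (a + b)\<close> the same trace. The number of occurrences of its first letter can
  then be cancelled for each nonempty word.\<close>

lemma Tr_BCH: "Tr (BCH (var a) (var b)) = Tr (var a + var b :: 'k::comm_rat_algebra ncs)"
proof (rule ncs_eqI)
  fix w
  let ?L = "BCH (var a) (var b) :: 'k ncs"
  have "Tr (deg v ?L) = Tr (deg v (var a + var b))" for v
  proof -
    have "Tr (deg v ?L) = Tr (ad_subst exp_quot ?L (deg v ?L))"
      by (simp add: Tr_ad_subst order_ge_BCH exp_quot_def of_Q_1)
    also have "\<dots> = Tr (deg v (var a + var b))"
      unfolding ad_exp_quot_deg_BCH
      by (simp add: linear_map_add[OF linear_map_Tr] linear_map_add[OF linear_map_deg] deg_var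
          Tr_conjugate nc_exp_uminus_mult order_ge_var)
    finally show ?thesis .
  qed
  then have deg: "deg v (Tr ?L) = deg v (Tr (var a + var b))" for v
    by (simp add: deg_Tr)
  show "coeff (Tr ?L) w = coeff (Tr (var a + var b)) w"
  proof (cases w)
    case Nil
    then show ?thesis
      using order_ge_BCH[of "var a" "var b :: 'k ncs"]
      by (simp add: coeff_Tr_Nil order_ge_coeff_Nil coeff_monom)
  next
    case (Cons v u)
    have "coeff (deg v (Tr ?L)) w = coeff (deg v (Tr (var a + var b))) w"
      by (simp add: deg)
    moreover have "count_list w v \<noteq> 0"
      by (simp add: Cons)
    ultimately show ?thesis
      using of_nat_mult_cancel[of "count_list w v"] by simp
  qed
qed

section \<open>The contribution of \<beta> to the trace identity\<close>

lemma beta_eq: "beta = eta - fps_const (1/2) * fps_X"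
  by (simp add: eta_def)

lemma subst_beta:
  "order_ge (Suc 0) S \<Longrightarrow> subst beta S = subst eta S - scale (of_Q (1/2)) S"
  by (simp add: beta_eq subst_diff subst_const_mult subst_X)

lemma subst_eta_uminus: "order_ge (Suc 0) S \<Longrightarrow> subst eta (- S) = subst eta S"
  by (simp add: subst_minus eta_even)

lemma odd_part_subst_eta_var: "odd_part (subst eta (var v)) = 0"
  by (simp add: odd_part_eq multiplicative.twist_subst[OF multiplicative_sign] order_ge_var
      twist_sign_var subst_eta_uminus)

text \<open>As \<eta> is even, the change of sign takes \<open>\<eta>(BCH a b)\<close> to
  \<open>\<eta>(BCH b a)\<close>, which is a conjugate; the odd part is half of their
  difference.\<close>

lemma Tr_odd_part_subst_eta_BCH:
  "Tr (odd_part (subst eta (BCH (var a) (var b)))) = (0 :: 'k::comm_rat_algebra ncs)"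
proof -
  have conj: "subst eta (BCH (var b) (var a)) =
      nc_exp (var b) * subst eta (BCH (var a) (var b)) * (nc_exp (- var b) :: 'k ncs)"
    by (simp add: BCH_conjugate[of "var b" "var a"] order_ge_var subst_conjugate order_ge_BCH
        nc_exp_uminus_mult nc_exp_mult_uminus)
  have "odd_part (subst eta (BCH (var a) (var b :: 'k ncs))) = scale (of_Q (1/2))
      (subst eta (BCH (var a) (var b)) - subst eta (BCH (var b) (var a)))"
    by (simp add: odd_part_eq multiplicative.twist_subst[OF multiplicative_sign] order_ge_BCH
        twist_sign_BCH subst_eta_uminus)
  then show ?thesis
    by (simp add: conj linear_map_scale[OF linear_map_Tr] linear_map_diff[OF linear_map_Tr]
        Tr_conjugate nc_exp_uminus_mult order_ge_var)
qed

lemma Tr_odd_part_BCH: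
  "Tr (odd_part (BCH (var a) (var b))) = Tr (var a + var b :: 'k::comm_rat_algebra ncs)"
proof -
  have "Tr (odd_part (BCH (var a) (var b))) =
      scale (of_Q (1/2)) (Tr (var a + var b)) + scale (of_Q (1/2)) (Tr (var a + var b :: 'k ncs))"
    by (simp add: odd_part_BCH linear_map_scale[OF linear_map_Tr] linear_map_add[OF linear_map_Tr]
        Tr_BCH scale_add add_ac)
  then show ?thesis by (simp only: scale_half_double)
qed

text \<open>With \<open>\<beta>(u) = \<eta>(u) - u/2\<close> the \<eta>-terms drop out, and the
  linear terms cancel by \<open>Tr_odd_part_BCH\<close>.\<close>

lemma Tr_odd_part_beta:
  "Tr (odd_part (subst beta (var a) + subst beta (var b) - subst beta (BCH (var a) (var b)) - 1)) =
    (0 :: 'k::comm_rat_algebra ncs)"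
proof -
  have "odd_part 1 = (0 :: 'k ncs)"
    by (rule ncs_eqI) (simp add: odd_part_def coeff_1)
  then show ?thesis
    by (simp add: subst_beta order_ge_var order_ge_BCH linear_map_diff[OF linear_map_odd_part]
        linear_map_add[OF linear_map_odd_part] linear_map_scale[OF linear_map_odd_part]
        odd_part_subst_eta_var odd_part_var linear_map_diff[OF linear_map_Tr]
        linear_map_uminus[OF linear_map_Tr]
        linear_map_add[OF linear_map_Tr] linear_map_scale[OF linear_map_Tr]
        Tr_odd_part_subst_eta_BCH Tr_odd_part_BCH scale_add)
qed

section \<open>End selection and the identities (a) and (b')\<close>

lemma linear_map_ER: "linear_map (ER v)"
  unfolding linear_map_def by (auto intro!: ncs_eqI simp: ER_def)

lemma ER_var: "ER v (var x) = (if x = v then var x else 0)"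
  by (rule ncs_eqI) (auto simp: ER_def coeff_monom)

lemma ER_X_plus_ER_Y: "coeff P [] = 0 \<Longrightarrow> ER X P + ER Y P = P"
  by (rule ncs_eqI) (auto simp: ER_def intro: letter.exhaust)

theorem theorem6p2:
  fixes A B :: "letter \<Rightarrow> 'k::comm_rat_algebra ncs"
  assumes lie_A: "\<And>V. lie_series (A V)"
    and lie_B: "\<And>V. lie_series (B V)"
    and AB: "\<And>V. tensor (var X) (A V) + tensor (var Y) (B V) =
        deltaL V (even_part (var X + var Y - BCH (var Y) (var X)))"
  shows "\<forall>V.
     even_part (var X + var Y - BCH (var Y) (var X)) =
       bracket (var X) (A V) + bracket (var Y) (B V)
   \<and> Tr (ER X (ad_subst eta (var X) (A V))) + Tr (ER Y (ad_subst eta (var Y) (B V))) =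
       scale (of_Q (1/2))
         (Tr (odd_part (subst beta (var X) + subst beta (var Y)
                        - subst beta (BCH (var X) (var Y)) - 1)))
     - scale (of_Q (1/2))
         (Tr (ER X (odd_part (var X + var Y - BCH (var Y) (var X)))))"
proof -
  let ?P = "var X + var Y - BCH (var Y) (var X) :: 'k ncs"
  let ?h = "scale (of_Q (1/2)) :: 'k ncs \<Rightarrow> 'k ncs"
  let ?O = "odd_part (BCH (var Y) (var X)) :: 'k ncs"
  have even: "even_part ?P = ?h (BCH (var X) (var Y) - BCH (var Y) (var X))"
    by (simp add: linear_map_diff[OF linear_map_even_part] linear_map_add[OF linear_map_even_part]
        even_part_var even_part_BCH scale_diff)
  have odd: "odd_part ?P = var X + var Y - ?O"
    by (simp add: linear_map_diff[OF linear_map_odd_part] linear_map_add[OF linear_map_odd_part]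
        odd_part_var)
  have odd': "odd_part (BCH (var X) (var Y)) = ?O"
    by (simp add: odd_part_BCH add.commute)
  have bracket_0: "bracket S 0 = 0" for S :: "'k ncs"
    by (simp add: bracket_def)
  note lin = linear_map_diff linear_map_add linear_map_scale linear_map_uminus linear_map_0
  note TrER = lin[OF linear_map_Tr] lin[OF linear_map_ER]
  \<comment> \<open>The even part is a single bracket in two ways, with outer letter
    \<open>X\<close> or \<open>Y\<close>; each form suits \<open>deltaL\<close> for the other
    letter.\<close>
  have P_Y: "even_part ?P = bracket (var X) (sol Y X)"
    by (simp add: even bracket_sol)
  have P_X: "even_part ?P = bracket (var Y) (- sol X Y)"
    by (simp add: even bracket_sol linear_map_uminus[OF linear_map_bracket] flip: scale_uminus)
  have A: "coeff (A V) q = deltaL V (even_part ?P) [X] q" for V q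
    unfolding AB[symmetric] by (simp add: tensor_def coeff_monom)
  have B: "coeff (B V) q = deltaL V (even_part ?P) [Y] q" for V q
    unfolding AB[symmetric] by (simp add: tensor_def coeff_monom)
  \<comment> \<open>This is \<open>deltaL_bracket\<close> with \<open>a = Y\<close> and
    \<open>b = X\<close>; for \<open>V = X\<close> the letters are exchanged and a sign
    appears.\<close>
  have "A Y = sol Y X \<and> B Y = 0"
    by (auto intro!: ncs_eqI simp: A B P_Y deltaL_bracket Dynkin_sol coeff_sol_pure)
  then have Y: "A Y = sol Y X" "B Y = 0" by auto
  have "A X = 0 \<and> B X = - sol X Y"
    by (auto intro!: ncs_eqI simp: A B P_X deltaL_bracket Dynkin_sol coeff_sol_pure
        lin[OF linear_map_rquot] lin[OF linear_map_adh_left] lin[OF linear_map_deg])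
  then have X: "A X = 0" "B X = - sol X Y" by auto
  have rhs: "?h (Tr (odd_part (subst beta (var X) + subst beta (var Y)
                        - subst beta (BCH (var X) (var Y)) - 1)))
     - ?h (Tr (ER X (odd_part ?P))) = - ?h (Tr (ER X (odd_part ?P)))"
    by (simp add: Tr_odd_part_beta)
  \<comment> \<open>For \<open>V = X\<close> the left hand side of (b') involves words ending with
    \<open>Y\<close>. As the odd part has trace \<open>0\<close>, they can be traded for those
    ending with \<open>X\<close> at the cost of a sign.\<close>
  have "Tr (ER X (odd_part ?P)) + Tr (ER Y (odd_part ?P)) = Tr (ER X (odd_part ?P) + ER Y (odd_part ?P))"
    by (simp add: TrER)
  also have "ER X (odd_part ?P) + ER Y (odd_part ?P) = odd_part ?P"
    by (rule ER_X_plus_ER_Y) (simp add: odd_part_def)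
  also have "Tr (odd_part ?P) = 0"
    by (simp add: odd Tr_odd_part_BCH TrER add.commute)
  finally have swap: "Tr (ER Y (odd_part ?P)) = - Tr (ER X (odd_part ?P))"
    by (simp add: eq_neg_iff_add_eq_0 add.commute)
  show ?thesis
  proof (intro allI conjI)
    fix V
    show "even_part ?P = bracket (var X) (A V) + bracket (var Y) (B V)"
      using P_X P_Y by (cases V) (simp_all add: X Y bracket_0)
    show "Tr (ER X (ad_subst eta (var X) (A V))) + Tr (ER Y (ad_subst eta (var Y) (B V))) =
       ?h (Tr (odd_part (subst beta (var X) + subst beta (var Y)
                        - subst beta (BCH (var X) (var Y)) - 1)))
     - ?h (Tr (ER X (odd_part ?P)))"
      unfolding rhs
    proof (cases V)
      case Y
      \<comment> \<open>The letter \<open>Y\<close> in the odd part is killed by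
        \<open>ER X\<close>; the remaining \<open>X - ?O\<close> is \<open>-2\<close> times the
        series in \<open>eta_sol\<close>.\<close>
      have "ER X (ad_subst eta (var X) (sol Y X)) = - ?h (ER X (odd_part ?P))"
        by (simp add: eta_sol odd TrER ER_var scale_diff)
      then show "Tr (ER X (ad_subst eta (var X) (A V))) + Tr (ER Y (ad_subst eta (var Y) (B V))) =
          - ?h (Tr (ER X (odd_part ?P)))"
        by (simp add: Y \<open>A Y = sol Y X\<close> \<open>B Y = 0\<close> ad_subst_zero TrER)
    next
      case X
      have "ER Y (ad_subst eta (var Y) (- sol X Y)) = ?h (ER Y (odd_part ?P))"
        by (simp add: eta_sol odd odd' lin[OF linear_map_ad_subst] TrER ER_var scale_diff)
      then show "Tr (ER X (ad_subst eta (var X) (A V))) + Tr (ER Y (ad_subst eta (var Y) (B V))) =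
          - ?h (Tr (ER X (odd_part ?P)))"
        by (simp add: X \<open>A X = 0\<close> \<open>B X = - sol X Y\<close> ad_subst_zero TrER swap scale_uminus)
    qed
  qed
qed

end
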